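(* Let $n \geq 1$ and let $M^n$ be a closed, convex hypersurface in $\mathbb{R}^{n+1}$ enclosing a domain $\Omega^{n+1}$ of volume $\mathrm{Vol}(\Omega)$. Suppose $\alpha : M \to M$ is a continuous map without fixed points, let $\mu(\alpha) = \min_{x \in M} d_M(x,\alpha(x))$, let $\rho(\alpha) = \max_{x \in M} \frac{d_M(x,\alpha(x))}{|\alpha(x) - x|}$, and let $K_{n+1} = \frac{2}{\sqrt{3}\,(n+1)!}$. Then $$\mathrm{Vol}(\Omega) > \left( \frac{K_{n+1}}{\rho(\alpha)^{n+1}} \right) \mu(\alpha)^{n+1}.$$
   Context: A closed, convex hypersurface $M^n$ in $\mathbb{R}^{n+1}$ is the boundary of a compact convex set with nonempty interior in $\mathbb{R}^{n+1}$ (the domain it encloses); no smoothness is assumed. $\mathrm{Vol}$ denotes $(n+1)$-dimensional Hausdorff measure. The intrinsic distance $d_M(x,y)$ is the minimal length of a path contained in $M$ connecting $x$ and $y$, and $|\cdot|$ is the Euclidean norm. *)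

theory Defs
  imports "HOL-Analysis.Analysis"
begin

text \<open>
  Hausdorff measure of integer dimension, as an outer measure on all subsets. The factor
  \<^term>\<open>unit_ball_vol (real d) / 2 ^ d\<close> is the usual normalisation, for which
  the \<open>d\<close>-dimensional measure on \<open>d\<close>-dimensional Euclidean space is Lebesgue measure.
  The sets of a cover are required to be bounded because \<^const>\<open>diameter\<close> is meaningless
  otherwise; the empty set contributes nothing, also for \<open>d = 0\<close>.
\<close>

definition hausdorff_gauge :: "nat \<Rightarrow> 'a::metric_space set \<Rightarrow> ennreal" where
  "hausdorff_gauge d S =
     (if S = {} then 0 else ennreal (unit_ball_vol (real d) * (diameter S / 2) ^ d))"

definition hausdorff_premeasure :: "nat \<Rightarrow> real \<Rightarrow> 'a::metric_space set \<Rightarrow> ennreal" where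
  "hausdorff_premeasure d \<delta> A =
     (INF C \<in> {C :: nat \<Rightarrow> 'a set.
                 A \<subseteq> (\<Union>i. C i) \<and> (\<forall>i. bounded (C i) \<and> diameter (C i) \<le> \<delta>)}.
        \<Sum>i. hausdorff_gauge d (C i))"

definition hausdorff_measure :: "nat \<Rightarrow> 'a::metric_space set \<Rightarrow> ennreal" where
  "hausdorff_measure d A = (SUP \<delta> \<in> {0<..}. hausdorff_premeasure d \<delta> A)"

text \<open>
  Length of a path: supremum of the lengths of inscribed polygons, over all partitions
  \<open>t 0 \<le> \<dots> \<le> t N\<close> of points of the unit interval.
\<close>

definition path_length :: "(real \<Rightarrow> 'a::metric_space) \<Rightarrow> ennreal" where
  "path_length g =
     (SUP (N, t) \<in> {(N :: nat, t :: nat \<Rightarrow> real). mono_on {..N} t \<and> t ` {..N} \<subseteq> {0..1}}.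
        \<Sum>i<N. ennreal (dist (g (t i)) (g (t (Suc i)))))"

text \<open>The value is \<open>\<infinity>\<close> if no path of finite length in \<open>M\<close> joins the points.\<close>

definition intrinsic_dist :: "'a::metric_space set \<Rightarrow> 'a \<Rightarrow> 'a \<Rightarrow> ennreal" where
  "intrinsic_dist M x y =
     (INF g \<in> {g. path g \<and> path_image g \<subseteq> M \<and> pathstart g = x \<and> pathfinish g = y}.
        path_length g)"

definition closed_convex_hypersurface_enclosing ::
    "'a::euclidean_space set \<Rightarrow> 'a set \<Rightarrow> bool" where
  "closed_convex_hypersurface_enclosing M \<Omega> \<longleftrightarrow>
     compact \<Omega> \<and> convex \<Omega> \<and> interior \<Omega> \<noteq> {} \<and> M = frontier \<Omega>"

text \<open>
  Minimum and maximum over \<open>M\<close> are rendered by infimum and supremum in \<open>[0, \<infinity>]\<close>; these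
  agree with the minimum and maximum whenever the latter are attained.
\<close>

definition min_displacement :: "'a::metric_space set \<Rightarrow> ('a \<Rightarrow> 'a) \<Rightarrow> ennreal" where
  "min_displacement M \<alpha> = (INF x \<in> M. intrinsic_dist M x (\<alpha> x))"

definition max_distortion :: "'a::real_normed_vector set \<Rightarrow> ('a \<Rightarrow> 'a) \<Rightarrow> ennreal" where
  "max_distortion M \<alpha> = (SUP x \<in> M. intrinsic_dist M x (\<alpha> x) / ennreal (norm (\<alpha> x - x)))"

definition K_const :: "nat \<Rightarrow> real" where
  "K_const m = 2 / (sqrt 3 * fact m)"

end

theory Submission
  imports Defs
begin

text \<open>
  Write $m = n + 1$ and let $\delta$ be the least Euclidean displacement $|\alpha(x) - x|$. Since
  $d_M(x, \alpha(x)) \le \rho(\alpha)\, |\alpha(x) - x|$, taking $x$ to be the minimiser gives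
  $\mu(\alpha) \le \rho(\alpha)\,\delta$. Hence it is enough to bound the volume of $\Omega$ from below by
  $2\delta^m / (\sqrt 3\, m!)$, and to obtain strictness either there or in
  $\mu(\alpha) \le \rho(\alpha)\,\delta$. If $\rho(\alpha)$ is infinite or zero, the right-hand side
  is zero.

  The map enters the volume bound through one topological fact (\<open>opposite_pair_along_direction\<close>): in every direction
  $u$ some $x$ satisfies $\alpha(x) - x \parallel u$. If the shadow of $\Omega$ on the hyperplane
  $u^\perp$ could be lifted continuously to the upper side of $M$, this would be the Brouwer theorem for
  the map lift, then $\alpha$, then projection. The upper side need not be a continuous graph at the
  boundary of the shadow, so lifts that are only approximately right are used, followed by a compactness
  argument. By convexity $\Omega$ then has chords of every direction and of every length up to
  $\delta$; in other words its width is at least $\delta$ in every direction.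

  A convex body with this property satisfies the desired volume bound. In the plane this is
  the theorem of Pal (\<open>pal\<close>): the area is at least $\delta^2/\sqrt 3$, with equality only for an
  equilateral triangle of height $\delta$. The proof compares the body with an inscribed triangle of
  largest area; on each side of it the width forces a further triangle to lie in the body.
  In higher dimension, a body that has a chord of length $L$ in a coordinate direction has at
  least $L/k$ times the volume of its $(k-1)$-dimensional shadow along that direction, $k$ being its
  dimension, by comparison with a cone (\<open>measure_cylinder_insert\<close>). Shadows inherit the chords, so the planar
  bound can be iterated up to dimension $m$. For $m \ge 3$ strictness is gained by rotating a diameter
  of the body into a coordinate axis: either the diameter exceeds $\delta$, or the planar shadow
  is too small to be the extremal triangle.

  For $m = 2$ and $\Omega$ the extremal triangle, strictness has to come from the intrinsic distances. In the
  direction of an altitude the only chord of length $\delta$ is the altitude itself, so $\alpha$ sends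
  either a vertex to the foot of its altitude or that foot to the vertex, and these two points are half the
  perimeter apart in $M$. Hence $\rho(\alpha)\,\delta$ is at least half the perimeter. If $\mu(\alpha)$ were
  also at least half the perimeter, $\alpha$ would send every point to its antipode along the
  perimeter; but a point at a quarter of a side is at distance less than $\delta$ from its antipode.

  Finally, the volume is given as a Hausdorff measure, while the argument above computes Lebesgue measure. That
  Hausdorff measure is at least Lebesgue measure follows from the isodiametric
  inequality (\<open>isodiametric\<close>), proved by Steiner symmetrization. Rotations are applied on the side of
  Hausdorff measure, where their effect is controlled by mapping covers.
\<close>

section \<open>Chords in every direction\<close>

text \<open>
  For compact convex sets this says that the width in every direction is at least \<open>w\<close>. The formulation by
  chords is the one that passes to linear images and that the fixed point argument provides.
\<close>

definition chords_upto :: "real \<Rightarrow> 'a::real_normed_vector set \<Rightarrow> bool" where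
  "chords_upto w K \<longleftrightarrow> (\<forall>v. norm v \<le> w \<longrightarrow> (\<exists>p\<in>K. \<exists>q\<in>K. q - p = v))"

lemma chords_uptoD: "chords_upto w K \<Longrightarrow> norm v \<le> w \<Longrightarrow> \<exists>p\<in>K. \<exists>q\<in>K. q - p = v"
  by (simp add: chords_upto_def)

text \<open>
  Let $\pi$ be the orthogonal projection along $u$. The Brouwer theorem is applied on the shadow $\pi\Omega$ to
  $\pi \circ \alpha \circ s$, where $s$ lifts the shadow to $M$. A continuous lift with $\pi \circ s$ close to
  the identity is obtained by compressing the direction $u$ by a small factor $\epsilon$, taking
  in the flattened body the closest point to $y + u$, and decompressing. In the flattened
  body all heights are nearly zero, so that the closest point lies nearly below $y + u$.
\<close>

lemma opposite_pair_along_direction: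
  fixes \<Omega> :: "'a::euclidean_space set"
  assumes \<Omega>: "compact \<Omega>" "convex \<Omega>" "\<Omega> \<noteq> {}"
    and \<alpha>: "continuous_on (frontier \<Omega>) \<alpha>" "\<alpha> \<in> frontier \<Omega> \<rightarrow> frontier \<Omega>"
    and u: "norm u = 1"
  obtains x c where "x \<in> frontier \<Omega>" "\<alpha> x - x = c *\<^sub>R u"
proof -
  define \<pi> where "\<pi> = (\<lambda>x. x - (x \<bullet> u) *\<^sub>R u)"
  have uu: "u \<bullet> u = 1" using u by (simp add: dot_square_norm)
  have lin\<pi>: "linear \<pi>" unfolding \<pi>_def
    by (rule linearI) (auto simp: algebra_simps inner_add_left)
  have cont\<pi>: "continuous_on A \<pi>" for A
    unfolding \<pi>_def by (intro continuous_intros)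
  have clM: "compact (frontier \<Omega>)" using \<Omega> by (simp add: compact_frontier)
  have M\<Omega>: "frontier \<Omega> \<subseteq> \<Omega>" using \<Omega> by (simp add: compact_imp_closed frontier_subset_closed)
  obtain C where C: "\<And>x. x \<in> \<Omega> \<Longrightarrow> norm x \<le> C" "C > 0"
    using \<Omega>(1) by (metis compact_imp_bounded bounded_pos)
  have near: "\<exists>x\<in>frontier \<Omega>. norm (\<pi> (\<alpha> x) - \<pi> x) \<le> \<eta>" if \<eta>: "\<eta> > 0" for \<eta>
  proof -
    \<comment> \<open>The first bound keeps \<open>y + u\<close> above the flattened body;
      the second makes the horizontal error at most \<open>\<eta>\<close>.\<close>
    define \<epsilon> where "\<epsilon> = min (1 / (2 * C)) (\<eta>\<^sup>2 / (4 * C))"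
    have \<epsilon>: "\<epsilon> > 0" "\<epsilon> * C \<le> 1/2" "4 * (\<epsilon> * C) \<le> \<eta>\<^sup>2"
    proof -
      show "\<epsilon> > 0" using C \<eta> by (simp add: \<epsilon>_def)
      have "\<epsilon> * C \<le> 1 / (2 * C) * C" unfolding \<epsilon>_def using C(2) by (intro mult_right_mono) auto
      then show "\<epsilon> * C \<le> 1/2" using C(2) by simp
      have "\<epsilon> * C \<le> \<eta>\<^sup>2 / (4 * C) * C" unfolding \<epsilon>_def using C(2) by (intro mult_right_mono) auto
      then show "4 * (\<epsilon> * C) \<le> \<eta>\<^sup>2" using C(2) by simp
    qed
    define A where "A = (\<lambda>x. x + ((\<epsilon> - 1) * (x \<bullet> u)) *\<^sub>R u)"
    define A' where "A' = (\<lambda>x. x + ((1/\<epsilon> - 1) * (x \<bullet> u)) *\<^sub>R u)"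
    have linA: "linear A" unfolding A_def
      by (rule linearI) (auto simp: algebra_simps inner_add_left)
    have contA: "continuous_on S A" and contA': "continuous_on S A'" for S
      unfolding A_def A'_def by (intro continuous_intros)+
    have A'A: "A' (A x) = x" for x
      using \<epsilon>(1) uu by (simp add: A_def A'_def inner_add_left algebra_simps flip: scaleR_add_left)
    have A\<pi>: "A x = \<pi> x + (\<epsilon> * (x \<bullet> u)) *\<^sub>R u" for x
      by (simp add: A_def \<pi>_def algebra_simps)
    define S where "S = A ` \<Omega>"
    have S: "compact S" "convex S" "S \<noteq> {}"
      using \<Omega> contA linA by (auto simp: S_def intro: compact_continuous_image convex_linear_image)
    define s where "s = (\<lambda>y. A' (closest_point S (y + u)))"
    define B where "B = \<pi> ` \<Omega>"
    have B: "compact B" "convex B" "B \<noteq> {}"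
      using \<Omega> cont\<pi> lin\<pi> by (auto simp: B_def intro: compact_continuous_image convex_linear_image)
    have conts: "continuous_on B s"
    proof -
      have "continuous_on B (\<lambda>y. closest_point S (y + u))"
        using S by (intro continuous_on_compose2[of UNIV "closest_point S" B "\<lambda>y. y + u"]
          continuous_on_closest_point continuous_intros) (auto simp: compact_imp_closed)
      then show ?thesis
        unfolding s_def using continuous_on_compose[of B "\<lambda>y. closest_point S (y + u)" A'] contA'
        by (auto simp: o_def)
    qed
    have s: "s y \<in> frontier \<Omega>" "norm (\<pi> (s y) - y) \<le> \<eta>" if y: "y \<in> B" for y
    proof -
      define z where "z = closest_point S (y + u)"
      have "z \<in> S" using S by (simp add: z_def closest_point_in_set compact_imp_closed)
      then obtain x where x: "x \<in> \<Omega>" "z = A x" by (auto simp: S_def)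
      have sx: "s y = x" using x A'A by (simp add: s_def z_def)
      have zle: "norm (y + u - z) \<le> norm (y + u - A v)" if "v \<in> \<Omega>" for v
        using closest_point_le[of S "A v" "y + u"] S that
        by (auto simp: z_def dist_norm S_def compact_imp_closed)
      have xu: "\<bar>v \<bullet> u\<bar> \<le> C" if "v \<in> \<Omega>" for v
        using Cauchy_Schwarz_ineq2[of v u] C(1)[OF that] u by simp
      have eu: "\<bar>\<epsilon> * (v \<bullet> u)\<bar> \<le> \<epsilon> * C" if "v \<in> \<Omega>" for v
        using xu[OF that] \<epsilon>(1) by (simp add: abs_mult)
      obtain v where v: "v \<in> \<Omega>" "y = \<pi> v" using y by (auto simp: B_def)
      have nsq: "(norm (y + u - A v'))\<^sup>2 = (norm (y - \<pi> v'))\<^sup>2 + (1 - \<epsilon> * (v' \<bullet> u))\<^sup>2" for v'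
      proof -
        have "\<pi> v'' \<bullet> u = 0" for v'' using uu by (simp add: \<pi>_def inner_diff_left)
        then have o: "(y - \<pi> v') \<bullet> u = 0" using v by (simp add: inner_diff_left)
        have e: "y + u - A v' = (y - \<pi> v') + (1 - \<epsilon> * (v' \<bullet> u)) *\<^sub>R u"
          by (simp add: A\<pi> algebra_simps)
        show ?thesis unfolding e
          using o by (subst norm_add_Pythagorean) (auto simp: orthogonal_def u)
      qed
      \<comment> \<open>An interior point could be moved up along \<open>u\<close>, closer to \<open>y + u\<close>.\<close>
      have "x \<notin> interior \<Omega>"
      proof
        assume "x \<in> interior \<Omega>"
        then obtain e where e: "e > 0" "cball x e \<subseteq> \<Omega>" by (auto simp: mem_interior_cball)
        define t where "t = min e C"
        have t: "t > 0" "x + t *\<^sub>R u \<in> \<Omega>" "t \<le> C"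
          using e C u by (auto simp: t_def dist_norm intro!: subsetD[OF e(2)])
        have \<pi>t: "\<pi> (x + t *\<^sub>R u) = \<pi> x" using uu by (simp add: \<pi>_def inner_add_left algebra_simps)
        have "(norm (y + u - z))\<^sup>2 \<le> (norm (y + u - A (x + t *\<^sub>R u)))\<^sup>2"
          using zle[OF t(2)] by (simp add: power_mono)
        then have le: "(1 - \<epsilon> * (x \<bullet> u))\<^sup>2 \<le> (1 - \<epsilon> * ((x + t *\<^sub>R u) \<bullet> u))\<^sup>2"
          unfolding x(2) nsq \<pi>t by simp
        have "1 - \<epsilon> * ((x + t *\<^sub>R u) \<bullet> u) \<ge> 0" using eu[OF t(2)] \<epsilon> by linarith
        then have "1 - \<epsilon> * (x \<bullet> u) \<le> 1 - \<epsilon> * ((x + t *\<^sub>R u) \<bullet> u)"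
          using le power2_le_imp_le by blast
        then have "\<epsilon> * t \<le> 0" using uu by (simp add: inner_add_left algebra_simps)
        then show False using \<epsilon>(1) t(1) by (simp add: mult_le_0_iff)
      qed
      then show "s y \<in> frontier \<Omega>"
        using x(1) sx \<Omega> by (simp add: frontier_def compact_imp_closed)
      have "(norm (y + u - z))\<^sup>2 \<le> (norm (y + u - A v))\<^sup>2"
        using zle[OF v(1)] by (simp add: power_mono)
      then have "(norm (y - \<pi> x))\<^sup>2 + (1 - \<epsilon> * (x \<bullet> u))\<^sup>2 \<le> (1 - \<epsilon> * (v \<bullet> u))\<^sup>2"
        unfolding x(2) nsq v(2)[symmetric] by simp
      moreover have "(1 - \<epsilon> * (v \<bullet> u))\<^sup>2 \<le> (1 + \<epsilon> * C)\<^sup>2"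
        using eu[OF v(1)] \<epsilon> by (intro power_mono) linarith+
      moreover have "(1 - \<epsilon> * C)\<^sup>2 \<le> (1 - \<epsilon> * (x \<bullet> u))\<^sup>2"
        using eu[OF x(1)] \<epsilon> by (intro power_mono) linarith+
      ultimately have "(norm (y - \<pi> x))\<^sup>2 \<le> 4 * (\<epsilon> * C)"
        by (simp add: power2_eq_square algebra_simps)
      then have "(norm (y - \<pi> x))\<^sup>2 \<le> \<eta>\<^sup>2" using \<epsilon>(3) by linarith
      then show "norm (\<pi> (s y) - y) \<le> \<eta>"
        using \<eta> sx power2_le_imp_le[of "norm (y - \<pi> x)" \<eta>] by (simp add: norm_minus_commute)
    qed
    have sB: "s ` B \<subseteq> frontier \<Omega>" using s by auto
    have "continuous_on B (\<lambda>y. \<pi> (\<alpha> (s y)))"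
      using continuous_on_compose[OF conts, of \<alpha>] sB \<alpha>(1)
        continuous_on_compose[of B "\<alpha> \<circ> s" \<pi>] cont\<pi>
      by (auto simp: o_def intro: continuous_on_subset)
    moreover have "(\<lambda>y. \<pi> (\<alpha> (s y))) \<in> B \<rightarrow> B"
      using s(1) \<alpha>(2) M\<Omega> by (fastforce simp: B_def)
    ultimately obtain y where y: "y \<in> B" "\<pi> (\<alpha> (s y)) = y"
      using brouwer[OF B] by blast
    then show ?thesis using s[OF y(1)] by (metis norm_minus_commute)
  qed
  obtain x where x: "x \<in> frontier \<Omega>"
    and min: "\<And>z. z \<in> frontier \<Omega> \<Longrightarrow> norm (\<pi> (\<alpha> x) - \<pi> x) \<le> norm (\<pi> (\<alpha> z) - \<pi> z)"
  proof -
    have "continuous_on (frontier \<Omega>) (\<lambda>x. norm (\<pi> (\<alpha> x) - \<pi> x))"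
      using continuous_on_compose[OF \<alpha>(1), of \<pi>] cont\<pi>
      by (intro continuous_intros) (auto simp: o_def)
    moreover have "frontier \<Omega> \<noteq> {}" using near[of 1] by auto
    ultimately show ?thesis
      using continuous_attains_inf[OF clM] that by blast
  qed
  have "\<pi> (\<alpha> x) = \<pi> x"
  proof (rule ccontr)
    assume "\<pi> (\<alpha> x) \<noteq> \<pi> x"
    then have pos: "norm (\<pi> (\<alpha> x) - \<pi> x) > 0" by simp
    obtain z where "z \<in> frontier \<Omega>" "norm (\<pi> (\<alpha> z) - \<pi> z) \<le> norm (\<pi> (\<alpha> x) - \<pi> x) / 2"
      using near[of "norm (\<pi> (\<alpha> x) - \<pi> x) / 2"] pos by auto
    then show False using min[of z] pos by linarith
  qed
  then have "\<alpha> x - x = ((\<alpha> x - x) \<bullet> u) *\<^sub>R u"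
    by (simp add: \<pi>_def algebra_simps inner_diff_left)
  then show thesis using x that by blast
qed

text \<open>
  Chords shorter than the one between $x$ and $\alpha(x)$ are found inside that chord by convexity.
\<close>

lemma chords_upto_min_displacement:
  fixes \<Omega> :: "'a::euclidean_space set"
  assumes \<Omega>: "compact \<Omega>" "convex \<Omega>" "\<Omega> \<noteq> {}"
    and \<alpha>: "continuous_on (frontier \<Omega>) \<alpha>" "\<alpha> \<in> frontier \<Omega> \<rightarrow> frontier \<Omega>"
    and \<delta>: "\<And>x. x \<in> frontier \<Omega> \<Longrightarrow> \<delta> \<le> norm (\<alpha> x - x)"
  shows "chords_upto \<delta> \<Omega>"
  unfolding chords_upto_def
proof (intro allI impI)
  fix v :: 'a assume v: "norm v \<le> \<delta>"
  show "\<exists>p\<in>\<Omega>. \<exists>q\<in>\<Omega>. q - p = v"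
  proof (cases "v = 0")
    case True
    then show ?thesis using \<Omega>(3) by force
  next
    case False
    define u where "u = v /\<^sub>R norm v"
    have u: "norm u = 1" using False by (simp add: u_def)
    obtain x c where x: "x \<in> frontier \<Omega>" "\<alpha> x - x = c *\<^sub>R u"
      using opposite_pair_along_direction[OF \<Omega> \<alpha> u] .
    have M\<Omega>: "frontier \<Omega> \<subseteq> \<Omega>" using \<Omega> by (simp add: compact_imp_closed frontier_subset_closed)
    then have in\<Omega>: "x \<in> \<Omega>" "\<alpha> x \<in> \<Omega>" using x \<alpha>(2) by auto
    have cv: "\<bar>c\<bar> \<ge> norm v" using \<delta>[OF x(1)] v u by (simp add: x(2))
    have c0: "c \<noteq> 0" using cv False by auto
    define k where "k = norm v / \<bar>c\<bar>"
    have k: "0 \<le> k" "k \<le> 1" using cv c0 by (auto simp: k_def)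
    have chord: "a + k *\<^sub>R (b - a) \<in> \<Omega>" if "a \<in> \<Omega>" "b \<in> \<Omega>" for a b
      using convexD[OF \<Omega>(2) that, of "1 - k" k] k by (simp add: algebra_simps)
    have kc: "(k * \<bar>c\<bar>) *\<^sub>R u = v" using c0 False by (simp add: k_def u_def)
    show ?thesis
    proof (cases "c > 0")
      case True
      then have "x + k *\<^sub>R (\<alpha> x - x) - x = v" using kc by (simp add: x(2))
      then show ?thesis using chord[OF in\<Omega>] in\<Omega> by blast
    next
      case False
      then have "(\<alpha> x + k *\<^sub>R (x - \<alpha> x)) - \<alpha> x = v"
        using kc c0 x(2) by (simp add: algebra_simps flip: scaleR_minus_left)
      then show ?thesis using chord[OF in\<Omega>(2,1)] in\<Omega> by blast
    qed
  qed
qed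

section \<open>Planar convex sets: the Pal inequality\<close>

text \<open>
  Twice the signed area of the triangle \<open>P Q X\<close>; the quotients by the value for a fixed third vertex
  are barycentric coordinates.
\<close>

definition cross_area :: "real^2 \<Rightarrow> real^2 \<Rightarrow> real^2 \<Rightarrow> real" where
  "cross_area P Q X = (Q$1 - P$1) * (X$2 - P$2) - (X$1 - P$1) * (Q$2 - P$2)"

lemma cross_area_rotate: "cross_area Q R P = cross_area P Q R"
  by (simp add: cross_area_def algebra_simps)

lemma cross_area_swap: "cross_area Q P X = - cross_area P Q X"
  by (simp add: cross_area_def algebra_simps)

lemma cross_area_add:
  "cross_area Q R X + cross_area R P X + cross_area P Q X = cross_area P Q R"
  by (simp add: cross_area_def algebra_simps)

lemma cross_area_affine:
  "cross_area P Q X =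
    vector [P$2 - Q$2, Q$1 - P$1] \<bullet> X - vector [P$2 - Q$2, Q$1 - P$1] \<bullet> P"
  by (simp add: cross_area_def inner_vec_def sum_2 algebra_simps)

lemma dist_real2: "(dist P Q)\<^sup>2 = (Q$1 - P$1)\<^sup>2 + (Q$2 - P$2)\<^sup>2" for P Q :: "real^2"
  by (simp add: dist_vec_def L2_set_def sum_2 dist_real_def power2_commute)

lemma convex_cross_area_sides:
  "convex {X. cross_area P Q X \<ge> 0}" "convex {X. cross_area P Q X \<le> 0}"
  using convex_halfspace_ge[of "vector [P$2 - Q$2, Q$1 - P$1] \<bullet> P" "vector [P$2 - Q$2, Q$1 - P$1]"]
    convex_halfspace_le[of "vector [P$2 - Q$2, Q$1 - P$1]" "vector [P$2 - Q$2, Q$1 - P$1] \<bullet> P"]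
  by (simp_all add: cross_area_affine)

lemma negligible_cross_area_line:
  assumes "P \<noteq> Q" shows "negligible {X. cross_area P Q X = 0}"
proof -
  have "vector [P$2 - Q$2, Q$1 - P$1] \<noteq> (0::real^2)"
    using assms by (auto simp: vec_eq_iff forall_2)
  then show ?thesis
    unfolding cross_area_affine right_minus_eq by (intro negligible_hyperplane) simp
qed

lemma measure_triangle:
  "measure lebesgue (convex hull {P,Q,X}) = \<bar>cross_area P Q X\<bar> / 2"
proof -
  have "measure lebesgue (convex hull {P,Q,X}) = measure lborel (convex hull {P,Q,X})"
    by (intro measure_completion) (simp add: compact_imp_closed finite_imp_compact_convex_hull borel_closed)
  then show ?thesis by (simp add: content_triangle cross_area_def abs_minus_commute mult.commute)
qed

lemma triangle_lmeasurable: "convex hull {P,Q,X::real^2} \<in> lmeasurable"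
  by (simp add: finite_imp_compact_convex_hull lmeasurable_compact)

text \<open>
  The width of \<open>K\<close> perpendicular to \<open>PQ\<close>, expressed through areas: the chord of length \<open>w\<close> is
  taken orthogonal to \<open>PQ\<close>.
\<close>

lemma cross_area_chord:
  fixes K :: "(real^2) set"
  assumes diff: "chords_upto w K" and w: "w \<ge> 0"
  obtains x y where "x \<in> K" "y \<in> K" "cross_area P Q x - cross_area P Q y = w * dist P Q"
proof (cases "P = Q")
  case True
  obtain x where "x \<in> K" using chords_uptoD[OF diff, of 0] w by auto
  then show thesis using that[of x x] True by simp
next
  case False
  then have d: "dist P Q > 0" by simp
  define n :: "real^2" where "n = vector [P$2 - Q$2, Q$1 - P$1]"
  have nn: "n \<bullet> n = (dist P Q)\<^sup>2"
    unfolding dist_real2 by (simp add: n_def inner_vec_def sum_2 power2_eq_square algebra_simps)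
  then have nn': "norm n = dist P Q" by (simp add: norm_eq_sqrt_inner)
  obtain p q where pq: "p \<in> K" "q \<in> K" "q - p = (w / dist P Q) *\<^sub>R n"
    using chords_uptoD[OF diff, of "(w / dist P Q) *\<^sub>R n"] w d nn' by auto
  have "cross_area P Q q - cross_area P Q p = n \<bullet> (q - p)"
    by (simp add: cross_area_affine n_def inner_diff_right)
  also have "\<dots> = w * dist P Q" using d nn by (simp add: pq(3) power2_eq_square)
  finally show thesis using that pq by blast
qed

text \<open>
  The points of \<open>K\<close> that realise the width perpendicular to the chord span two triangles with it.
  Either they lie on opposite sides and the areas add up, or the farther one alone is large enough.
\<close>

lemma area_ge_chord_times_width:
  fixes K :: "(real^2) set"
  assumes K: "compact K" "convex K"
    and diff: "chords_upto w K" and w: "w \<ge> 0"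
    and PQ: "P \<in> K" "Q \<in> K"
  shows "measure lebesgue K \<ge> w * dist P Q / 2"
proof (cases "P = Q")
  case False
  obtain x y where xy: "x \<in> K" "y \<in> K" "cross_area P Q x - cross_area P Q y = w * dist P Q"
    using cross_area_chord[OF diff w] .
  have sub: "convex hull {P,Q,z} \<subseteq> K" if "z \<in> K" for z
    using PQ that K by (simp add: subset_hull)
  have Km: "K \<in> lmeasurable" using K by (simp add: lmeasurable_compact)
  have tri: "measure lebesgue K \<ge> \<bar>cross_area P Q z\<bar> / 2" if "z \<in> K" for z
    using measure_mono_fmeasurable[OF sub[OF that] _ Km] triangle_lmeasurable[of P Q z]
    by (simp add: measure_triangle fmeasurableD)
  have wd: "w * dist P Q \<ge> 0" using w by simp
  consider "cross_area P Q y \<ge> 0" | "cross_area P Q x \<le> 0"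
    | "cross_area P Q y \<le> 0" "cross_area P Q x \<ge> 0" by linarith
  then show ?thesis
  proof cases
    case 1 then show ?thesis using tri[OF xy(1)] xy(3) wd by linarith
  next
    case 2 then show ?thesis using tri[OF xy(2)] xy(3) wd by linarith
  next
    case 3
    have z: "cross_area P Q P = 0" "cross_area P Q Q = 0" by (auto simp: cross_area_def)
    have a: "convex hull {P,Q,x} \<subseteq> {X. cross_area P Q X \<ge> 0}"
      using 3 z by (intro hull_minimal convex_cross_area_sides) auto
    have b: "convex hull {P,Q,y} \<subseteq> {X. cross_area P Q X \<le> 0}"
      using 3 z by (intro hull_minimal convex_cross_area_sides) auto
    have "negligible (convex hull {P,Q,x} \<inter> convex hull {P,Q,y})"
      by (rule negligible_subset[OF negligible_cross_area_line[OF False]]) (use a b in force)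
    then have "measure lebesgue (convex hull {P,Q,x} \<union> convex hull {P,Q,y})
      = measure lebesgue (convex hull {P,Q,x}) + measure lebesgue (convex hull {P,Q,y})"
      using measure_Un3[OF triangle_lmeasurable triangle_lmeasurable, of P Q x P Q y]
      by (simp add: negligible_imp_measure0)
    moreover have "measure lebesgue (convex hull {P,Q,x} \<union> convex hull {P,Q,y}) \<le> measure lebesgue K"
      using sub xy triangle_lmeasurable[of P Q x] triangle_lmeasurable[of P Q y]
      by (intro measure_mono_fmeasurable Km) (auto simp: fmeasurableD)
    ultimately show ?thesis using 3 xy(3) by (simp add: measure_triangle)
  qed
qed (use w in simp)

text \<open>
  If no point of \<open>K\<close> is farther than \<open>D\<close> on the positive side of \<open>PQ\<close>, then the width leaves the rest of
  the extent to the other side. When nothing is left, the degenerate triangle with third vertex \<open>P\<close>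
  serves.
\<close>

lemma bump_triangle:
  fixes K :: "(real^2) set"
  assumes diff: "chords_upto w K" and w: "w \<ge> 0"
    and PQ: "P \<in> K" and le: "\<And>X. X \<in> K \<Longrightarrow> cross_area P Q X \<le> D"
  obtains x where "x \<in> K" "cross_area P Q x \<le> 0" "- cross_area P Q x \<ge> w * dist P Q - D"
proof -
  obtain x y where xy: "x \<in> K" "y \<in> K" "cross_area P Q x - cross_area P Q y = w * dist P Q"
    using cross_area_chord[OF diff w] .
  show thesis
  proof (cases "w * dist P Q - D \<ge> 0")
    case True then show thesis using that[of y] xy le[of x] by auto
  next
    case False
    moreover have "cross_area P Q P = 0" by (simp add: cross_area_def)
    ultimately show thesis using that[of P] PQ by auto
  qed
qed

text \<open>
  The hexagon consisting of a largest inscribed triangle and one bump beyond each side lies in \<open>K\<close>. The bumps do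
  not overlap: maximality bounds all barycentric coordinates on \<open>K\<close> by one, so a point at which two
  of them are nonpositive has both equal to zero.
\<close>

lemma area_ge_max_triangle_hexagon:
  fixes K :: "(real^2) set"
  assumes K: "compact K" "convex K"
    and diff: "chords_upto w K" and w: "w \<ge> 0"
    and PQR: "P \<in> K" "Q \<in> K" "R \<in> K"
    and max: "\<And>X Y Z. \<lbrakk>X \<in> K; Y \<in> K; Z \<in> K\<rbrakk> \<Longrightarrow> \<bar>cross_area X Y Z\<bar> \<le> cross_area P Q R"
    and pos: "cross_area P Q R > 0"
  shows "measure lebesgue K \<ge> w * (dist Q R + dist R P + dist P Q) / 2 - cross_area P Q R"
proof -
  define D where "D = cross_area P Q R"
  have rot: "cross_area Q R P = D" "cross_area R P Q = D"
    by (simp_all add: D_def cross_area_rotate)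
  have neq: "P \<noteq> Q" "Q \<noteq> R" "R \<noteq> P" using pos by (auto simp: cross_area_def)
  have le: "cross_area X Y Z \<le> D" if "X \<in> K" "Y \<in> K" "Z \<in> K" for X Y Z
    using max[OF that] by (simp add: D_def)
  obtain xa where xa: "xa \<in> K" "cross_area Q R xa \<le> 0" "- cross_area Q R xa \<ge> w * dist Q R - D"
    using bump_triangle[OF diff w PQR(2), of R D] le PQR by blast
  obtain xb where xb: "xb \<in> K" "cross_area R P xb \<le> 0" "- cross_area R P xb \<ge> w * dist R P - D"
    using bump_triangle[OF diff w PQR(3), of P D] le PQR by blast
  obtain xc where xc: "xc \<in> K" "cross_area P Q xc \<le> 0" "- cross_area P Q xc \<ge> w * dist P Q - D"
    using bump_triangle[OF diff w PQR(1), of Q D] le PQR by blast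
  define T :: "nat \<Rightarrow> (real^2) set" where
    "T = (\<lambda>i. if i = 0 then convex hull {P,Q,R} else if i = 1 then convex hull {Q,R,xa}
               else if i = 2 then convex hull {R,P,xb} else convex hull {P,Q,xc})"
  have Tm: "T i \<in> lmeasurable" for i by (simp add: T_def triangle_lmeasurable)
  have zero: "cross_area X Y X = 0" "cross_area X Y Y = 0" for X Y by (auto simp: cross_area_def)
  have sub: "convex hull {X,Y,Z} \<subseteq> K" if "X \<in> K" "Y \<in> K" "Z \<in> K" for X Y Z
    using that K by (simp add: subset_hull)
  have TK: "T i \<subseteq> K" for i unfolding T_def using sub PQR xa xb xc by auto
  have hull3: "convex hull {X,Y,Z} \<subseteq> S" if "X \<in> S" "Y \<in> S" "Z \<in> S" "convex S" for X Y Z and S :: "(real^2) set"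
    using that by (intro hull_minimal) auto
  have T0: "T 0 \<subseteq> {X. cross_area P Q X \<ge> 0}" "T 0 \<subseteq> {X. cross_area Q R X \<ge> 0}"
    "T 0 \<subseteq> {X. cross_area R P X \<ge> 0}"
  proof -
    have "T 0 = convex hull {P,Q,R}" by (simp add: T_def)
    moreover have "D > 0" using pos by (simp add: D_def)
    ultimately show "T 0 \<subseteq> {X. cross_area P Q X \<ge> 0}" "T 0 \<subseteq> {X. cross_area Q R X \<ge> 0}"
      "T 0 \<subseteq> {X. cross_area R P X \<ge> 0}"
      using zero rot D_def by (simp_all add: hull3 convex_cross_area_sides)
  qed
  have "convex hull {Q,R,xa} \<subseteq> {X. cross_area Q R X \<le> 0}"
    using zero xa by (intro hull3 convex_cross_area_sides) simp_all
  then have T1: "T 1 \<subseteq> {X. cross_area Q R X \<le> 0}" by (simp add: T_def)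
  have "convex hull {R,P,xb} \<subseteq> {X. cross_area R P X \<le> 0}"
    using zero xb by (intro hull3 convex_cross_area_sides) simp_all
  then have T2: "T 2 \<subseteq> {X. cross_area R P X \<le> 0}" by (simp add: T_def)
  have "convex hull {P,Q,xc} \<subseteq> {X. cross_area P Q X \<le> 0}"
    using zero xc by (intro hull3 convex_cross_area_sides) simp_all
  then have T3: "T 3 \<subseteq> {X. cross_area P Q X \<le> 0}" by (simp add: T_def)
  have sep: "cross_area Q R X = 0 \<and> cross_area R P X = 0"
    if "X \<in> K" "cross_area Q R X \<le> 0" "cross_area R P X \<le> 0" for X
    using cross_area_add[of Q R X P] le[OF PQR(1,2) that(1)] that by (simp add: D_def)
  have sep2: "cross_area R P X = 0 \<and> cross_area P Q X = 0"
    if "X \<in> K" "cross_area R P X \<le> 0" "cross_area P Q X \<le> 0" for X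
    using cross_area_add[of Q R X P] le[OF PQR(2,3) that(1)] that by (simp add: D_def)
  have sep3: "cross_area Q R X = 0 \<and> cross_area P Q X = 0"
    if "X \<in> K" "cross_area Q R X \<le> 0" "cross_area P Q X \<le> 0" for X
    using cross_area_add[of Q R X P] le[OF PQR(3,1) that(1)] that by (simp add: D_def)
  have n01: "T 0 \<inter> T 1 \<subseteq> {X. cross_area Q R X = 0}" using T0 T1 by force
  have n02: "T 0 \<inter> T 2 \<subseteq> {X. cross_area R P X = 0}" using T0 T2 by force
  have n03: "T 0 \<inter> T 3 \<subseteq> {X. cross_area P Q X = 0}" using T0 T3 by force
  have n12: "T 1 \<inter> T 2 \<subseteq> {X. cross_area Q R X = 0}" using TK[of 1] sep T1 T2 by auto
  have n13: "T 1 \<inter> T 3 \<subseteq> {X. cross_area Q R X = 0}" using TK[of 1] sep3 T1 T3 by auto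
  have n23: "T 2 \<inter> T 3 \<subseteq> {X. cross_area R P X = 0}" using TK[of 2] sep2 T2 T3 by auto
  note lines = negligible_cross_area_line[OF neq(1)] negligible_cross_area_line[OF neq(2)]
    negligible_cross_area_line[OF neq(3)]
  have neg: "negligible (T 0 \<inter> T 1)" "negligible (T 0 \<inter> T 2)" "negligible (T 0 \<inter> T 3)"
    "negligible (T 1 \<inter> T 2)" "negligible (T 1 \<inter> T 3)" "negligible (T 2 \<inter> T 3)"
    by (rule negligible_subset[OF lines(2) n01] negligible_subset[OF lines(3) n02]
      negligible_subset[OF lines(1) n03] negligible_subset[OF lines(2) n12]
      negligible_subset[OF lines(2) n13] negligible_subset[OF lines(3) n23])+
  have "pairwise (\<lambda>i j. negligible (T i \<inter> T j)) {0,1,2,3}"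
    using neg by (auto simp: pairwise_def Int_commute)
  then have "measure lebesgue (\<Union>(T ` {0,1,2,3})) = (\<Sum>i\<in>{0,1,2,3}. measure lebesgue (T i))"
    using Tm by (intro measure_negligible_finite_Union_image) auto
  also have "\<dots> = D / 2 + \<bar>cross_area Q R xa\<bar> / 2 + \<bar>cross_area R P xb\<bar> / 2 + \<bar>cross_area P Q xc\<bar> / 2"
    using pos by (simp add: T_def measure_triangle D_def)
  also have "\<dots> \<ge> D / 2 + (w * dist Q R - D) / 2 + (w * dist R P - D) / 2 + (w * dist P Q - D) / 2"
    unfolding abs_of_nonpos[OF xa(2)] abs_of_nonpos[OF xb(2)] abs_of_nonpos[OF xc(2)]
    by (intro add_mono divide_right_mono order_refl xa(3) xb(3) xc(3)) auto
  finally have "measure lebesgue (\<Union>(T ` {0,1,2,3})) \<ge>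
      D / 2 + (w * dist Q R - D) / 2 + (w * dist R P - D) / 2 + (w * dist P Q - D) / 2" .
  moreover have "measure lebesgue (\<Union>(T ` {0,1,2,3})) \<le> measure lebesgue K"
    using TK Tm K by (intro measure_mono_fmeasurable) (auto simp: lmeasurable_compact fmeasurableD)
  ultimately show ?thesis unfolding D_def[symmetric] by (simp add: field_simps)
qed

lemma am_gm_3:
  fixes x y z :: real assumes "x \<ge> 0" "y \<ge> 0" "z \<ge> 0"
  shows "27 * (x * y * z) \<le> (x + y + z) ^ 3"
proof -
  have "0 \<le> x * (y - z)\<^sup>2 + y * (z - x)\<^sup>2 + z * (x - y)\<^sup>2" using assms by simp
  moreover have "0 \<le> (x + y + z) * ((x - y)\<^sup>2 + (y - z)\<^sup>2 + (z - x)\<^sup>2)" using assms by simp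
  ultimately show ?thesis by (simp add: power2_eq_square power3_eq_cube algebra_simps)
qed

text \<open>
  Heron's formula together with the inequality of the means for the three factors.
\<close>

lemma triangle_isoperimetric:
  "6 * sqrt 3 * \<bar>cross_area P Q R\<bar> \<le> (dist Q R + dist R P + dist P Q)\<^sup>2"
proof -
  define a b c where "a = dist Q R" and "b = dist R P" and "c = dist P Q"
  define s where "s = (a + b + c) / 2"
  have tri: "a \<le> b + c" "b \<le> c + a" "c \<le> a + b"
    unfolding a_def b_def c_def by (metis dist_commute dist_triangle add.commute)+
  then have nn: "s - a \<ge> 0" "s - b \<ge> 0" "s - c \<ge> 0" by (auto simp: s_def)
  have s0: "s \<ge> 0" by (simp add: s_def a_def b_def c_def)
  have "measure lebesgue (convex hull {P,Q,R}) = measure lborel (convex hull {P,Q,R})"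
    by (intro measure_completion) (simp add: compact_imp_closed finite_imp_compact_convex_hull borel_closed)
  then have "\<bar>cross_area P Q R\<bar> / 2 = sqrt (s * (s - a) * (s - b) * (s - c))"
    by (simp add: measure_triangle heron s_def a_def b_def c_def dist_commute)
  then have "(\<bar>cross_area P Q R\<bar> / 2)\<^sup>2 = s * ((s - a) * (s - b) * (s - c))"
    using nn s0 by (simp add: mult.assoc)
  also have "27 * \<dots> \<le> s * ((s - a) + (s - b) + (s - c)) ^ 3"
    using mult_left_mono[OF am_gm_3[OF nn] s0] by (simp add: algebra_simps)
  also have "(s - a) + (s - b) + (s - c) = s" by (simp add: s_def field_simps)
  finally have "27 * (\<bar>cross_area P Q R\<bar> / 2)\<^sup>2 \<le> s ^ 4" by (simp add: power4_eq_xxxx power3_eq_cube algebra_simps)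
  then have "(6 * sqrt 3 * \<bar>cross_area P Q R\<bar>)\<^sup>2 \<le> (4 * s\<^sup>2)\<^sup>2"
    by (simp add: power_mult_distrib power_divide)
  then have "6 * sqrt 3 * \<bar>cross_area P Q R\<bar> \<le> 4 * s\<^sup>2"
    by (rule power2_le_imp_le) simp
  then show ?thesis by (simp add: s_def a_def b_def c_def power_divide)
qed


text \<open>
  Let $\sigma = 2w/\sqrt 3$ be the side of the equilateral triangle of height $w$. A chord longer than $\sigma$ is
  enough by the chord bound. Otherwise the perimeter $p$ of the largest inscribed triangle is at
  most $3\sigma$, and its area $D/2$ is at least $w^2/4$, which by the isoperimetric inequality gives
  $p > 3\sigma/2$. The hexagon bound $wp/2 - D$ is at least the concave quadratic
  $wp/2 - p^2/(6\sqrt 3)$, whose value is $w^2/\sqrt 3$ exactly at $p = 3\sigma/2$ and $p = 3\sigma$.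
  So equality forces $p = 3\sigma$, an equilateral triangle of that area inside \<open>K\<close>, which
  then exhausts \<open>K\<close>.
\<close>

lemma pal:
  fixes K :: "(real^2) set"
  assumes K: "compact K" "convex K"
    and diff: "chords_upto w K" and w: "w > 0"
  shows "measure lebesgue K > w\<^sup>2 / sqrt 3 \<or>
    measure lebesgue K = w\<^sup>2 / sqrt 3 \<and>
    (\<exists>P Q R. K = convex hull {P,Q,R} \<and>
      dist P Q = 2 * w / sqrt 3 \<and> dist Q R = 2 * w / sqrt 3 \<and> dist R P = 2 * w / sqrt 3)"
proof -
  have w0: "w \<ge> 0" using w by simp
  have Kne: "K \<noteq> {}" using chords_uptoD[OF diff, of 0] w by auto
  define \<sigma> where "\<sigma> = 2 * w / sqrt 3"
  have s3: "sqrt 3 * sqrt 3 = (3::real)" by simp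
  have w\<sigma>: "w = \<sigma> * sqrt 3 / 2" using s3 by (simp add: \<sigma>_def)
  have \<sigma>: "\<sigma> > 0" "w\<^sup>2 / sqrt 3 = w * \<sigma> / 2" "w\<^sup>2 / sqrt 3 = sqrt 3 / 4 * \<sigma>\<^sup>2"
    using w s3 by (simp_all add: \<sigma>_def power2_eq_square field_simps)
  obtain P Q R where PQR0: "P \<in> K" "Q \<in> K" "R \<in> K"
    and max0: "\<And>X Y Z. \<lbrakk>X \<in> K; Y \<in> K; Z \<in> K\<rbrakk> \<Longrightarrow> \<bar>cross_area X Y Z\<bar> \<le> \<bar>cross_area P Q R\<bar>"
  proof -
    have "compact (K \<times> K \<times> K)" "K \<times> K \<times> K \<noteq> {}"
      using K Kne by (auto intro: compact_Times)
    moreover have "continuous_on (K \<times> K \<times> K) (\<lambda>(X,Y,Z). \<bar>cross_area X Y Z\<bar>)"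
      unfolding cross_area_def case_prod_beta by (intro continuous_intros)
    ultimately obtain t where "t \<in> K \<times> K \<times> K"
      "\<And>y. y \<in> K \<times> K \<times> K \<Longrightarrow> (\<lambda>(X,Y,Z). \<bar>cross_area X Y Z\<bar>) y \<le> (\<lambda>(X,Y,Z). \<bar>cross_area X Y Z\<bar>) t"
      using continuous_attains_sup[of "K \<times> K \<times> K" "\<lambda>(X,Y,Z). \<bar>cross_area X Y Z\<bar>"] by blast
    then show thesis using that by (cases t) fastforce
  qed
  have nax: "norm (axis 1 w :: real^2) = w"
    using w by (simp add: norm_vec_def L2_set_def sum_2 axis_def)
  \<comment> \<open>A chord of length \<open>w\<close> and a point at distance at least \<open>w / 2\<close> from it span a large triangle.\<close>
  have big: "\<bar>cross_area P Q R\<bar> \<ge> w\<^sup>2 / 2" and int: "interior K \<noteq> {}"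
  proof -
    obtain p q where pq: "p \<in> K" "q \<in> K" "q - p = axis 1 w" using chords_uptoD[OF diff, of "axis 1 w"] w by (auto simp: nax)
    then have "dist p q = w" using nax by (metis dist_commute dist_norm)
    then have "measure lebesgue K \<ge> w * w / 2" using area_ge_chord_times_width[OF K diff w0 pq(1,2)] by simp
    then have pos: "measure lebesgue K > 0" using w by (smt (verit) half_gt_zero mult_pos_pos)
    then show "interior K \<noteq> {}"
      using negligible_convex_interior[OF K(2)] negligible_imp_measure0 by force
    obtain x y where "x \<in> K" "y \<in> K" "cross_area p q x - cross_area p q y = w * w"
      using cross_area_chord[OF diff w0, of p q] \<open>dist p q = w\<close> by metis
    then show "\<bar>cross_area P Q R\<bar> \<ge> w\<^sup>2 / 2" using max0[OF pq(1,2), of x] max0[OF pq(1,2), of y]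
      by (simp add: power2_eq_square)
  qed
  obtain P Q R where PQR: "P \<in> K" "Q \<in> K" "R \<in> K" and D: "cross_area P Q R \<ge> w\<^sup>2 / 2"
    and max: "\<And>X Y Z. \<lbrakk>X \<in> K; Y \<in> K; Z \<in> K\<rbrakk> \<Longrightarrow> \<bar>cross_area X Y Z\<bar> \<le> cross_area P Q R"
  proof (cases "cross_area P Q R \<ge> 0")
    case True then show thesis using that[of P Q R] PQR0 max0 big by simp
  next
    case False then show thesis using that[of Q P R] PQR0 max0 big by (simp add: cross_area_swap[of Q P])
  qed
  define a b c D where "a = dist Q R" and "b = dist R P" and "c = dist P Q"
    and "D = cross_area P Q R"
  define p where "p = a + b + c"
  have D0: "D > 0" using D w by (simp add: D_def) (smt (verit) zero_less_power2)
  have hexa: "measure lebesgue K \<ge> w * p / 2 - D"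
    using area_ge_max_triangle_hexagon[OF K diff w0 PQR max] D0
    by (simp add: D_def p_def a_def b_def c_def)
  have iso: "6 * sqrt 3 * D \<le> p\<^sup>2"
    using triangle_isoperimetric[of P Q R] D0 by (simp add: D_def p_def a_def b_def c_def)
  have side: "measure lebesgue K \<ge> w * dist X Y / 2" if "X \<in> K" "Y \<in> K" for X Y
    using area_ge_chord_times_width[OF K diff w0 that] .
  show ?thesis
  proof (cases "a \<le> \<sigma> \<and> b \<le> \<sigma> \<and> c \<le> \<sigma>")
    case False
    then obtain X Y where "X \<in> K" "Y \<in> K" "dist X Y > \<sigma>"
      using PQR by (auto simp: a_def b_def c_def not_le)
    then have "w * \<sigma> / 2 < measure lebesgue K"
      using side[of X Y] w by (smt (verit) divide_strict_right_mono mult_strict_left_mono)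
    then show ?thesis using \<sigma>(2) by linarith
  next
    case le: True
    have pp: "p \<ge> 0" "p \<le> 3 * \<sigma>" using le by (simp_all add: p_def a_def b_def c_def)
    have "6 * sqrt 3 * (w\<^sup>2 / 2) \<le> 6 * sqrt 3 * D" using D by (intro mult_left_mono) (auto simp: D_def)
    then have "p\<^sup>2 \<ge> 3 * sqrt 3 * w\<^sup>2" using iso by linarith
    moreover have "3 * sqrt 3 * w\<^sup>2 > (sqrt 3 * w)\<^sup>2"
      using w by (simp add: power_mult_distrib) 
    ultimately have "(sqrt 3 * w)\<^sup>2 < p\<^sup>2" by linarith
    then have "sqrt 3 * w < p" using power2_less_imp_less pp(1) by blast
    moreover have "sqrt 3 * w = (sqrt 3 * sqrt 3) * \<sigma> / 2" by (simp only: w\<sigma> ac_simps times_divide_eq_right)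
    ultimately have plow: "3 * \<sigma> / 2 < p" unfolding s3 by linarith
    have key: "w * p / 2 - p\<^sup>2 / (6 * sqrt 3) - w\<^sup>2 / sqrt 3 = (p - 3 * \<sigma> / 2) * (3 * \<sigma> - p) / (6 * sqrt 3)"
      using s3 by (simp add: \<sigma>(3) w\<sigma> field_simps power2_eq_square)
    have "D \<le> p\<^sup>2 / (6 * sqrt 3)" using iso by (simp add: field_simps)
    then have low: "measure lebesgue K \<ge> w\<^sup>2 / sqrt 3 + (p - 3 * \<sigma> / 2) * (3 * \<sigma> - p) / (6 * sqrt 3)"
      using hexa key by linarith
    show ?thesis
    proof (cases "p = 3 * \<sigma>")
      case False
      then have "(p - 3 * \<sigma> / 2) * (3 * \<sigma> - p) / (6 * sqrt 3) > 0" using pp plow by simp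
      then show ?thesis using low by linarith
    next
      case True
      then have eq: "a = \<sigma>" "b = \<sigma>" "c = \<sigma>" using le by (auto simp: p_def)
      define T where "T = convex hull {P,Q,R}"
      have TK: "T \<subseteq> K" using PQR K by (simp add: T_def subset_hull)
      have cT: "compact T" by (simp add: T_def finite_imp_compact_convex_hull)
      have mT: "measure lebesgue T = w\<^sup>2 / sqrt 3"
      proof -
        have "measure lebesgue T = measure lborel T"
          unfolding T_def by (intro measure_completion) (simp add: compact_imp_closed finite_imp_compact_convex_hull borel_closed)
        also have "\<dots> = sqrt (3 * \<sigma> / 2 * (3 * \<sigma> / 2 - \<sigma>) * (3 * \<sigma> / 2 - \<sigma>) * (3 * \<sigma> / 2 - \<sigma>))"
          using eq unfolding T_def a_def b_def c_def by (subst heron) (simp add: dist_commute)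
        also have "3 * \<sigma> / 2 * (3 * \<sigma> / 2 - \<sigma>) * (3 * \<sigma> / 2 - \<sigma>) * (3 * \<sigma> / 2 - \<sigma>) = (sqrt 3 / 4 * \<sigma>\<^sup>2)\<^sup>2"
          by (simp add: power_mult_distrib field_simps power2_eq_square)
        finally show ?thesis by (simp add: \<sigma>(3))
      qed
      show ?thesis
      proof (cases "K \<subseteq> T")
        case True
        then have "K = T" using TK by auto
        then show ?thesis using mT eq unfolding a_def b_def c_def T_def \<sigma>_def by blast
      next
        case False
        \<comment> \<open>Near a point outside the triangle \<open>K\<close> has interior points, which contribute area.\<close>
        then obtain x where x: "x \<in> K" "x \<notin> T" by auto
        have "x \<in> closure (interior K)"
          using x convex_closure_interior[OF K(2) int] closure_subset by auto
        moreover have "x \<in> - T" using x by simp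
        moreover have "open (- T)" using compact_imp_closed[OF cT] by (simp add: open_Compl)
        ultimately have ne: "interior K \<inter> - T \<noteq> {}"
          using open_Int_closure_eq_empty[of "- T" "interior K"] by blast
        have op: "open (interior K \<inter> - T)" by (intro open_Int open_interior \<open>open (- T)\<close>)
        define U where "U = interior K \<inter> - T"
        have Um: "U \<in> lmeasurable"
          using K op unfolding U_def
          by (intro lmeasurable_open) (auto intro: bounded_subset[OF compact_imp_bounded interior_subset])
        have "\<not> negligible U" using ne op open_not_negligible unfolding U_def by blast
        then have "measure lebesgue U > 0"
          using Um by (metis measure_nonneg negligible_iff_measure order_le_less)
        moreover have "measure lebesgue (T \<union> U) = measure lebesgue T + measure lebesgue U"
        proof -
          have "T \<inter> U = {}" by (auto simp: U_def)
          then show ?thesis using measure_Un3[of T lebesgue U] cT Um by (simp add: lmeasurable_compact)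
        qed
        moreover have "measure lebesgue (T \<union> U) \<le> measure lebesgue K"
          using TK K Um cT interior_subset[of K]
          by (intro measure_mono_fmeasurable) (auto simp: U_def lmeasurable_compact fmeasurableD)
        ultimately show ?thesis using mT by linarith
      qed
    qed
  qed
qed

section \<open>Integration along one coordinate\<close>

definition set_coord :: "real ^ 'd \<Rightarrow> 'd \<Rightarrow> real \<Rightarrow> real ^ 'd" where
  "set_coord x i t = (\<chi> j. if j = i then t else x $ j)"

lemma set_coord_nth [simp]: "set_coord x i t $ j = (if j = i then t else x $ j)"
  by (simp add: set_coord_def)

lemma continuous_on_set_coord [continuous_intros]:
  assumes "continuous_on S f" "continuous_on S g"
  shows "continuous_on S (\<lambda>x. set_coord (f x) i (g x))"
proof -
  have "continuous_on S (\<lambda>x. set_coord (f x) i (g x) $ j)" for j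
    using assms by (cases "j = i") (auto intro!: continuous_intros)
  then show ?thesis
    using continuous_on_vec_lambda[of S "\<lambda>j x. set_coord (f x) i (g x) $ j"] by (simp add: set_coord_def)
qed

lemma set_coord_measurable [measurable]:
  "(\<lambda>p. set_coord (snd p) i (fst p)) \<in> borel_measurable (lborel \<Otimes>\<^sub>M lborel)"
proof -
  have "(\<lambda>p. set_coord (snd p) i (fst p)) \<in> borel_measurable borel"
    by (intro borel_measurable_continuous_onI continuous_intros)
  moreover have "sets (lborel \<Otimes>\<^sub>M lborel :: (real \<times> (real^'a)) measure) = sets borel"
    unfolding borel_prod[symmetric] by (intro sets_pair_measure_cong) simp_all
  ultimately show ?thesis using measurable_cong_sets by blast
qed

lemma box_cart_prod: "(\<Prod>b\<in>Basis. (v :: real^'d) \<bullet> b) = (\<Prod>j\<in>UNIV. v $ j)"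
proof -
  have "inj (\<lambda>i::'d. axis i (1::real))" by (auto simp: inj_def axis_eq_axis)
  then show ?thesis
    by (simp add: Basis_vec_def UNION_singleton_eq_range prod.reindex inner_axis comp_def)
qed

lemma emeasure_box_cart:
  assumes "\<And>j. l $ j \<le> u $ j"
  shows "emeasure lborel (box l u) = ennreal (\<Prod>j\<in>UNIV. u $ j - l $ (j::'d::finite))"
proof -
  have "\<forall>b\<in>Basis. l \<bullet> b \<le> u \<bullet> b"
    using assms by (auto simp: Basis_vec_def inner_axis)
  then show ?thesis
    using box_cart_prod[of "u - l"] by (simp add: emeasure_lborel_box_eq)
qed

definition open_slab :: "'d::finite \<Rightarrow> (real ^ 'd) set" where
  "open_slab i = {x. 0 < x $ i \<and> x $ i < 1}"

lemma open_open_slab: "open (open_slab i)"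
  unfolding open_slab_def by (intro open_Collect_conj open_Collect_less continuous_intros)

lemma open_slab_borel [measurable]: "open_slab i \<in> sets borel"
  by (rule borel_open[OF open_open_slab])

text \<open>
  Lebesgue measure is unchanged if a coordinate is discarded and replaced by an independent one. To stay
  within one type, the discarded coordinate is not removed but normalised to the unit interval. This
  gives Fubini's theorem for a single coordinate without product spaces of varying dimension.
\<close>

lemma lborel_eq_distr_set_coord:
  "lborel = distr (density (lborel \<Otimes>\<^sub>M lborel) (indicator (UNIV \<times> open_slab i))) borel
     (\<lambda>p. set_coord (snd p) (i::'d::finite) (fst p))" (is "_ = distr ?N _ ?f")
proof (rule lborel_eqI)
  fix l u :: "real^'d" assume le: "\<And>b. b \<in> Basis \<Longrightarrow> l \<bullet> b \<le> u \<bullet> b"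
  have lu: "l $ j \<le> u $ j" for j
    using le[of "axis j 1"] by (auto simp: Basis_vec_def inner_axis)
  have [measurable]: "?f \<in> borel_measurable ?N"
    using set_coord_measurable by (simp add: measurable_density_eq1)
  have eq: "{p. ?f p \<in> box l u \<and> snd p \<in> open_slab i} = {l$i<..<u$i} \<times> box (set_coord l i 0) (set_coord u i 1)"
  proof (intro set_eqI iffI)
    fix p assume p: "p \<in> {p. ?f p \<in> box l u \<and> snd p \<in> open_slab i}"
    then have a: "l $ j < ?f p $ j \<and> ?f p $ j < u $ j" for j
      unfolding mem_box_cart mem_Collect_eq by blast
    have "set_coord l i 0 $ j < snd p $ j \<and> snd p $ j < set_coord u i 1 $ j" for j
      using a[of j] p by (cases "j = i") (auto simp: open_slab_def)
    then show "p \<in> {l$i<..<u$i} \<times> box (set_coord l i 0) (set_coord u i 1)"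
      using a[of i] by (simp add: mem_Times_iff mem_box_cart)
  next
    fix p assume "p \<in> {l$i<..<u$i} \<times> box (set_coord l i 0) (set_coord u i 1)"
    then have p: "l $ i < fst p" "fst p < u $ i"
      and a: "set_coord l i 0 $ j < snd p $ j \<and> snd p $ j < set_coord u i 1 $ j" for j
      unfolding mem_Times_iff mem_box_cart by auto
    have "l $ j < ?f p $ j \<and> ?f p $ j < u $ j" for j
      using p a[of j] by (cases "j = i") auto
    then show "p \<in> {p. ?f p \<in> box l u \<and> snd p \<in> open_slab i}"
      using a[of i] by (simp add: mem_box_cart open_slab_def)
  qed
  have "emeasure (distr ?N borel ?f) (box l u) = emeasure ?N (?f -` box l u \<inter> space ?N)"
    by (simp add: emeasure_distr)
  also have "\<dots> = emeasure (lborel \<Otimes>\<^sub>M lborel) {p. ?f p \<in> box l u \<and> snd p \<in> open_slab i}"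
    using measurable_sets[OF set_coord_measurable[of i], of "box l u"]
    by (subst emeasure_restricted)
       (simp_all add: space_pair_measure vimage_def Int_def conj_commute mem_Times_iff)
  also have "\<dots> = ennreal (u$i - l$i) * emeasure lborel (box (set_coord l i 0) (set_coord u i 1))"
    unfolding eq using lu by (subst lborel.emeasure_pair_measure_Times) auto
  also have "\<dots> = ennreal ((u$i - l$i) * (\<Prod>j\<in>UNIV. (set_coord u i 1 - set_coord l i 0) $ j))"
    using lu by (subst emeasure_box_cart) (auto simp: ennreal_mult' )
  also have "(\<Prod>j\<in>UNIV. (set_coord u i 1 - set_coord l i 0) $ j) = (\<Prod>j\<in>UNIV - {i}. u $ j - l $ j)"
    by (subst prod.remove[of UNIV i]) auto
  also have "(u$i - l$i) * \<dots> = (\<Prod>j\<in>UNIV. u $ j - l $ j)"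
    by (subst prod.remove[of UNIV i, symmetric]) auto
  finally show "emeasure (distr ?N borel ?f) (box l u) = ennreal (\<Prod>b\<in>Basis. (u - l) \<bullet> b)"
    unfolding box_cart_prod by simp
qed simp

lemma emeasure_as_pair:
  assumes [measurable]: "A \<in> sets borel"
  shows "emeasure lborel A =
    emeasure (lborel \<Otimes>\<^sub>M lborel) {p. set_coord (snd p) (i::'d::finite) (fst p) \<in> A \<and> snd p \<in> open_slab i}"
proof -
  let ?f = "\<lambda>p. set_coord (snd p) i (fst p)"
  let ?N = "density (lborel \<Otimes>\<^sub>M lborel) (indicator (UNIV \<times> open_slab i))"
  have [measurable]: "?f \<in> borel_measurable ?N"
    using set_coord_measurable by (simp add: measurable_density_eq1)
  have "emeasure lborel A = emeasure ?N (?f -` A \<inter> space ?N)"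
    by (subst lborel_eq_distr_set_coord[of i]) (simp add: emeasure_distr)
  also have "\<dots> = emeasure (lborel \<Otimes>\<^sub>M lborel) {p. ?f p \<in> A \<and> snd p \<in> open_slab i}"
    using measurable_sets[OF set_coord_measurable[of i], of A]
    by (subst emeasure_restricted)
       (simp_all add: space_pair_measure vimage_def Int_def conj_commute mem_Times_iff)
  finally show ?thesis .
qed

lemma pair_set_measurable:
  assumes [measurable]: "A \<in> sets borel"
  shows "{p. set_coord (snd p) (i::'d::finite) (fst p) \<in> A \<and> snd p \<in> open_slab i} \<in> sets (lborel \<Otimes>\<^sub>M lborel)"
proof -
  have "{p \<in> space (lborel \<Otimes>\<^sub>M lborel). set_coord (snd p) i (fst p) \<in> A \<and> snd p \<in> open_slab i} \<in> sets (lborel \<Otimes>\<^sub>M lborel)"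
    by measurable
  then show ?thesis by (simp add: space_pair_measure)
qed

lemma emeasure_slices:
  assumes A: "A \<in> sets borel"
  shows "emeasure lborel A =
    (\<integral>\<^sup>+t. emeasure lborel {x \<in> open_slab i. set_coord x (i::'d::finite) t \<in> A} \<partial>lborel)"
  unfolding emeasure_as_pair[OF A, of i]
  by (subst lborel.emeasure_pair_measure_alt[OF pair_set_measurable[OF A]])
     (auto intro!: nn_integral_cong arg_cong[where f = "emeasure lborel"])

text \<open>
  Fubini's theorem in the form of Cavalieri's principle for lines parallel to a coordinate axis.
\<close>

lemma emeasure_fibre_mono:
  assumes A: "A \<in> sets borel" and B: "B \<in> sets borel"
    and le: "\<And>x. c * emeasure lborel {t. set_coord x (i::'d::finite) t \<in> A} \<le> emeasure lborel {t. set_coord x i t \<in> B}"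
  shows "c * emeasure lborel A \<le> emeasure lborel B"
proof -
  have fib: "emeasure lborel A = (\<integral>\<^sup>+x. emeasure lborel ((\<lambda>t. (t, x)) -`
      {p. set_coord (snd p) i (fst p) \<in> A \<and> snd p \<in> open_slab i}) \<partial>lborel)"
    if "A \<in> sets borel" for A
    unfolding emeasure_as_pair[OF that, of i]
    by (rule lborel_pair.emeasure_pair_measure_alt2[OF pair_set_measurable[OF that]])
  have "c * emeasure lborel A = (\<integral>\<^sup>+x. c * emeasure lborel ((\<lambda>t. (t, x)) -`
      {p. set_coord (snd p) i (fst p) \<in> A \<and> snd p \<in> open_slab i}) \<partial>lborel)"
    unfolding fib[OF A]
    by (rule nn_integral_cmult[symmetric])
       (rule lborel_pair.measurable_emeasure_Pair2[OF pair_set_measurable[OF A]])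
  also have "\<dots> \<le> emeasure lborel B"
    unfolding fib[OF B]
  proof (rule nn_integral_mono)
    fix x
    show "c * emeasure lborel ((\<lambda>t. (t, x)) -` {p. set_coord (snd p) i (fst p) \<in> A \<and> snd p \<in> open_slab i})
      \<le> emeasure lborel ((\<lambda>t. (t, x)) -` {p. set_coord (snd p) i (fst p) \<in> B \<and> snd p \<in> open_slab i})"
      using le[of x] by (cases "x \<in> open_slab i") (simp_all add: vimage_def)
  qed
  finally show ?thesis .
qed

section \<open>Volume from shadows\<close>

text \<open>
  The product of the shadow of \<open>K\<close> on the coordinates in \<open>I\<close> with the open unit cube in the other
  coordinates. Its volume is the \<open>I\<close>-dimensional volume of the shadow, so shadows of all dimensions can be
  compared within the ambient space.
\<close>

definition cylinder :: "'d set \<Rightarrow> (real ^ 'd) set \<Rightarrow> (real ^ 'd) set" where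
  "cylinder I K = {x. (\<exists>k\<in>K. \<forall>j\<in>I. x $ j = k $ j) \<and> (\<forall>j. j \<notin> I \<longrightarrow> 0 < x $ j \<and> x $ j < 1)}"

lemma cylinder_UNIV [simp]: "cylinder UNIV K = K"
  by (auto simp: cylinder_def simp flip: vec_eq_iff)

lemma cylinder_borel [measurable]:
  assumes "compact K" shows "cylinder I K \<in> sets borel"
proof -
  define Z :: "(real^'a) set" where "Z = {z. \<forall>j\<in>I. z $ j = 0}"
  have "Z = (\<Inter>j\<in>I. {z. z $ j = 0})" by (auto simp: Z_def)
  then have "closed Z" by (auto intro!: closed_INT closed_Collect_eq continuous_intros)
  then have "closed (\<Union>k\<in>K. \<Union>z\<in>Z. {k + z})"
    using compact_closed_sums[OF assms, of Z] by simp
  moreover have "open {x::real^'a. \<forall>j\<in>-I. 0 < x $ j \<and> x $ j < 1}"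
  proof -
    have "{x::real^'a. \<forall>j\<in>-I. 0 < x $ j \<and> x $ j < 1} = (\<Inter>j\<in>-I. open_slab j)"
      by (auto simp: open_slab_def)
    then show ?thesis by (simp add: open_INT open_open_slab)
  qed
  moreover have "cylinder I K = (\<Union>k\<in>K. \<Union>z\<in>Z. {k + z}) \<inter> {x. \<forall>j\<in>-I. 0 < x $ j \<and> x $ j < 1}"
  proof -
    have "(\<exists>k\<in>K. \<forall>j\<in>I. x $ j = k $ j) \<longleftrightarrow> x \<in> (\<Union>k\<in>K. \<Union>z\<in>Z. {k + z})" for x
    proof
      assume "\<exists>k\<in>K. \<forall>j\<in>I. x $ j = k $ j"
      then obtain k where "k \<in> K" "\<forall>j\<in>I. x $ j = k $ j" by auto
      then have "k \<in> K" "x - k \<in> Z" "x = k + (x - k)" by (auto simp: Z_def)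
      then show "x \<in> (\<Union>k\<in>K. \<Union>z\<in>Z. {k + z})" by blast
    qed (auto simp: Z_def)
    then show ?thesis by (auto simp: cylinder_def)
  qed
  ultimately show ?thesis by auto
qed

lemma cylinder_bounded:
  assumes "compact K" shows "bounded (cylinder I K)"
proof -
  obtain C where C: "\<And>k. k \<in> K \<Longrightarrow> norm k \<le> C"
    using assms by (metis compact_imp_bounded bounded_iff)
  have "\<bar>x $ j\<bar> \<le> \<bar>C\<bar> + 1" if x: "x \<in> cylinder I K" for x j
  proof (cases "j \<in> I")
    case True
    then obtain k where "k \<in> K" "x $ j = k $ j" using x by (auto simp: cylinder_def)
    then show ?thesis using C[of k] component_le_norm_cart[of k j] by linarith
  next
    case False
    then show ?thesis using x by (auto simp: cylinder_def)
  qed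
  then have "norm x \<le> (\<Sum>j\<in>(UNIV::'a set). \<bar>C\<bar> + 1)" if "x \<in> cylinder I K" for x
    using norm_le_l1_cart[of x] that by (meson order_trans sum_mono)
  then show ?thesis by (rule boundedI)
qed

lemma cylinder_lmeasurable: "compact K \<Longrightarrow> cylinder I K \<in> lmeasurable"
  by (simp add: bounded_set_imp_lmeasurable cylinder_borel cylinder_bounded)

lemma emeasure_cylinder:
  assumes "compact K"
  shows "emeasure lborel (cylinder I K) = ennreal (measure lebesgue (cylinder I K))"
proof -
  have "emeasure lborel (cylinder I K) = emeasure lebesgue (cylinder I K)"
    using cylinder_borel[OF assms, of I] by simp
  also have "\<dots> = ennreal (measure lebesgue (cylinder I K))"
    by (rule emeasure_eq_measure2[OF cylinder_lmeasurable[OF assms]])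
  finally show ?thesis .
qed

lemma measure_cylinder_affine:
  assumes "compact K"
  shows "measure lebesgue (cylinder I ((\<lambda>k. c *\<^sub>R k + b) ` K))
    = \<bar>c\<bar> ^ card I * measure lebesgue (cylinder I (K :: (real^'d) set))"
proof -
  define m where "m = (\<lambda>j. if j \<in> I then c else 1)"
  define d :: "real^'d" where "d = (\<chi> j. if j \<in> I then b $ j else 0)"
  let ?S = "\<lambda>x. \<chi> j. m j * x $ j"
  have "cylinder I ((\<lambda>k. c *\<^sub>R k + b) ` K) = (+) d ` ?S ` cylinder I K"
  proof (intro set_eqI iffI)
    fix z assume z: "z \<in> cylinder I ((\<lambda>k. c *\<^sub>R k + b) ` K)"
    then obtain k where k: "k \<in> K" "\<And>j. j \<in> I \<Longrightarrow> z $ j = c * k $ j + b $ j"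
      by (auto simp: cylinder_def)
    define x where "x = (\<chi> j. if j \<in> I then k $ j else z $ j)"
    have "x \<in> cylinder I K" using k z by (auto simp: cylinder_def x_def intro!: bexI[of _ k])
    moreover have "z = d + ?S x" using k by (auto simp: vec_eq_iff d_def m_def x_def)
    ultimately show "z \<in> (+) d ` ?S ` cylinder I K" by blast
  next
    fix z assume "z \<in> (+) d ` ?S ` cylinder I K"
    then obtain x where x: "x \<in> cylinder I K" "z = d + ?S x" by blast
    then obtain k where k: "k \<in> K" "\<forall>j\<in>I. x $ j = k $ j" by (auto simp: cylinder_def)
    show "z \<in> cylinder I ((\<lambda>k. c *\<^sub>R k + b) ` K)"
      using k x by (auto simp: cylinder_def d_def m_def intro!: bexI[of _ k])
  qed
  moreover have "prod m UNIV = c ^ card I"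
    by (simp add: m_def prod.If_cases)
  ultimately show ?thesis
    using measure_stretch[OF cylinder_lmeasurable[OF assms, of I], of m]
    by (simp add: measure_translation power_abs)
qed

text \<open>
  The set \<open>N\<close> is the cone over the shadow of \<open>K\<close> on the coordinates in \<open>I\<close>: its slice at height \<open>s\<close> in the
  new coordinate is that shadow contracted by \<open>1 - s\<close> towards \<open>p\<close>. Its volume is the integral of
  \<open>(1 - s) ^ card I\<close> times the volume of the shadow.
\<close>

lemma measure_cylinder_cone:
  fixes K :: "(real^'d) set" and p :: "real^'d"
  assumes K: "compact K" and i: "i \<notin> I"
  defines "N \<equiv> (\<lambda>(s, k). set_coord ((1 - s) *\<^sub>R k + s *\<^sub>R p) i s) ` ({0..1} \<times> K)"
  shows "emeasure lborel (cylinder (insert i I) N) \<ge>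
    ennreal (measure lebesgue (cylinder I K) / real (Suc (card I)))"
proof -
  define V where "V = measure lebesgue (cylinder I K)"
  let ?n = "card I"
  have cN: "compact N"
    unfolding N_def using K
    by (intro compact_continuous_image compact_Times) (auto simp: case_prod_beta intro!: continuous_intros)
  have slice: "ennreal (V * (1 - t) ^ ?n) * indicator {0..1} t
      \<le> emeasure lborel {x \<in> open_slab i. set_coord x i t \<in> cylinder (insert i I) N}" for t
  proof (cases "t \<in> {0..1}")
    case True
    let ?K = "(\<lambda>k. (1 - t) *\<^sub>R k + t *\<^sub>R p) ` K"
    have "{x \<in> open_slab i. set_coord x i t \<in> cylinder (insert i I) N} = cylinder I ?K"
    proof (intro set_eqI iffI)
      fix x assume "x \<in> {x \<in> open_slab i. set_coord x i t \<in> cylinder (insert i I) N}"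
      then have xi: "0 < x $ i" "x $ i < 1" and x: "set_coord x i t \<in> cylinder (insert i I) N"
        by (auto simp: open_slab_def)
      from x obtain k' where k': "k' \<in> N" "\<And>j. j \<in> insert i I \<Longrightarrow> set_coord x i t $ j = k' $ j"
        and out: "\<And>j. j \<notin> insert i I \<Longrightarrow> 0 < set_coord x i t $ j \<and> set_coord x i t $ j < 1"
        unfolding cylinder_def by blast
      from k'(1) obtain s k where s: "k \<in> K" "k' = set_coord ((1 - s) *\<^sub>R k + s *\<^sub>R p) i s"
        by (auto simp: N_def)
      have "s = t" using k'(2)[of i] s by simp
      then have "\<forall>j\<in>I. x $ j = ((1 - t) *\<^sub>R k + t *\<^sub>R p) $ j"
        using k'(2) s i by (metis insertI2 set_coord_nth)
      moreover have "0 < x $ j \<and> x $ j < 1" if "j \<notin> I" for j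
        using that xi out[of j] by (cases "j = i") auto
      ultimately show "x \<in> cylinder I ?K" using s(1) by (auto simp: cylinder_def)
    next
      fix x assume x: "x \<in> cylinder I ?K"
      then obtain k where k: "k \<in> K" "\<And>j. j \<in> I \<Longrightarrow> x $ j = ((1 - t) *\<^sub>R k + t *\<^sub>R p) $ j"
        by (auto simp: cylinder_def)
      have out: "0 < x $ j \<and> x $ j < 1" if "j \<notin> I" for j
        using x that by (auto simp: cylinder_def)
      have "set_coord ((1 - t) *\<^sub>R k + t *\<^sub>R p) i t \<in> N"
        unfolding N_def by (rule image_eqI[of _ _ "(t, k)"]) (use True k in auto)
      moreover have "\<forall>j\<in>insert i I. set_coord x i t $ j = set_coord ((1 - t) *\<^sub>R k + t *\<^sub>R p) i t $ j"
        using k by auto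
      moreover have "\<forall>j. j \<notin> insert i I \<longrightarrow> 0 < set_coord x i t $ j \<and> set_coord x i t $ j < 1"
        using out by auto
      ultimately have "set_coord x i t \<in> cylinder (insert i I) N"
        unfolding cylinder_def by blast
      then show "x \<in> {x \<in> open_slab i. set_coord x i t \<in> cylinder (insert i I) N}"
        using out[OF i] by (simp add: open_slab_def)
    qed
    moreover have "compact ?K"
      using K by (intro compact_continuous_image continuous_intros) auto
    then have "emeasure lborel (cylinder I ?K) = ennreal (measure lebesgue (cylinder I ?K))"
      by (rule emeasure_cylinder)
    moreover have "measure lebesgue (cylinder I ?K) = V * (1 - t) ^ ?n"
      using True unfolding V_def measure_cylinder_affine[OF K] by simp
    ultimately show ?thesis using True by simp
  qed simp
  have "ennreal (V / real (Suc ?n)) = (\<integral>\<^sup>+t. ennreal (V * (1 - t) ^ ?n) * indicator {0..1} t \<partial>lborel)"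
  proof -
    have "((\<lambda>t. - V * (1 - t) ^ Suc ?n / real (Suc ?n)) has_real_derivative V * (1 - t) ^ ?n) (at t)" for t
      by (auto intro!: derivative_eq_intros simp del: of_nat_Suc power_Suc)
    then show ?thesis
      by (subst nn_integral_FTC_Icc[of _ 0 1 "\<lambda>t. - V * (1 - t) ^ Suc ?n / real (Suc ?n)"])
         (auto simp: V_def)
  qed
  also have "\<dots> \<le> emeasure lborel (cylinder (insert i I) N)"
    unfolding emeasure_slices[OF cylinder_borel[OF cN], of "insert i I" i]
    by (intro nn_integral_mono slice)
  finally show ?thesis by (simp add: V_def)
qed

text \<open>
  Adding one coordinate. Suppose that a line in the new direction meets the cone over the shadow, with apex
  at the shadow of the chord \<open>pq\<close>, at height \<open>t\<close>. By convexity it then meets the shadow of \<open>K\<close> in an interval of length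
  at least \<open>t * L\<close>, the chord contracted by \<open>t\<close>. Since the heights along the line lie between zero
  and their supremum, each line meets the shadow of \<open>K\<close> in at least \<open>L\<close> times the length in which it
  meets the cone.
\<close>

lemma measure_cylinder_insert:
  fixes K :: "(real^'d) set"
  assumes K: "compact K" "convex K" and i: "i \<notin> I"
    and pq: "p \<in> K" "q \<in> K" "\<And>j. j \<in> I \<Longrightarrow> p $ j = q $ j" "q $ i - p $ i = L" and L: "L > 0"
  shows "measure lebesgue (cylinder (insert i I) K) \<ge> L / real (Suc (card I)) * measure lebesgue (cylinder I K)"
proof -
  define N where "N = (\<lambda>(s, k). set_coord ((1 - s) *\<^sub>R k + s *\<^sub>R p) i s) ` ({0..1} \<times> K)"
  let ?J = "insert i I"
  have cN: "compact N"
    unfolding N_def using K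
    by (intro compact_continuous_image compact_Times) (auto simp: case_prod_beta intro!: continuous_intros)
  have step: "ennreal L * emeasure lborel (cylinder ?J N) \<le> emeasure lborel (cylinder ?J K)"
  proof (rule emeasure_fibre_mono[OF cylinder_borel[OF cN] cylinder_borel[OF K(1)]])
    fix x
    define S where "S = {t. set_coord x i t \<in> cylinder ?J N}"
    define F where "F = {t. set_coord x i t \<in> cylinder ?J K}"
    have Fm: "F \<in> sets lborel"
    proof -
      have "(\<lambda>t. set_coord x i t) \<in> borel_measurable borel"
        by (intro borel_measurable_continuous_onI continuous_intros)
      from measurable_sets[OF this cylinder_borel[OF K(1), of ?J]]
      show ?thesis by (simp add: F_def vimage_def)
    qed
    have S: "t \<in> {0..1} \<and> ennreal (L * t) \<le> emeasure lborel F" if "t \<in> S" for t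
    proof -
      from that obtain k' where k': "k' \<in> N" "\<And>j. j \<in> ?J \<Longrightarrow> set_coord x i t $ j = k' $ j"
        and out: "\<And>j. j \<notin> ?J \<Longrightarrow> 0 < set_coord x i t $ j \<and> set_coord x i t $ j < 1"
        unfolding cylinder_def S_def by blast
      from k'(1) obtain s k where s: "k \<in> K" "s \<in> {0..1}" "k' = set_coord ((1 - s) *\<^sub>R k + s *\<^sub>R p) i s"
        by (auto simp: N_def)
      have st: "s = t" using k'(2)[of i] s by simp
      have xj: "x $ j = (1 - t) * k $ j + t * p $ j" if "j \<in> I" for j
        using k'(2)[of j] s that i st by (auto split: if_splits)
      let ?a = "(1 - t) * k $ i + t * p $ i"
      have "{?a..?a + L * t} \<subseteq> F"
      proof
        fix \<tau> assume \<tau>: "\<tau> \<in> {?a..?a + L * t}"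
        \<comment> \<open>Position of \<open>\<tau>\<close> relative to the contracted chord, which is a single point for \<open>t = 0\<close>.\<close>
        define \<theta> where "\<theta> = (if t = 0 then 0 else (\<tau> - ?a) / (L * t))"
        have t01: "0 \<le> t" "t \<le> 1" using s st by auto
        have \<theta>: "0 \<le> \<theta>" "\<theta> \<le> 1" "\<theta> * (L * t) = \<tau> - ?a"
          using \<tau> t01 L by (auto simp: \<theta>_def field_simps)
        define y where "y = (1 - t) *\<^sub>R k + t *\<^sub>R ((1 - \<theta>) *\<^sub>R p + \<theta> *\<^sub>R q)"
        have "y \<in> K"
          unfolding y_def using s pq \<theta> t01 K(2) by (intro convexD) (auto intro!: convexD)
        moreover have "set_coord x i \<tau> $ j = y $ j" if "j \<in> ?J" for j
        proof (cases "j = i")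
          case True
          have "y $ i = ?a + \<theta> * t * (q $ i - p $ i)" by (simp add: y_def algebra_simps)
          then show ?thesis using True \<theta>(3) pq(4) by (simp add: algebra_simps)
        next
          case False
          then have "j \<in> I" using that by simp
          then show ?thesis using False xj pq(3)[of j] by (simp add: y_def algebra_simps)
        qed
        moreover have "0 < set_coord x i \<tau> $ j \<and> set_coord x i \<tau> $ j < 1" if "j \<notin> ?J" for j
          using out[OF that] that by auto
        ultimately show "\<tau> \<in> F"
          unfolding F_def cylinder_def mem_Collect_eq by blast
      qed
      then have "emeasure lborel {?a..?a + L * t} \<le> emeasure lborel F"
        using Fm by (intro emeasure_mono)
      then show ?thesis using s st L by simp
    qed
    show "ennreal L * emeasure lborel {t. set_coord x i t \<in> cylinder ?J N}
        \<le> emeasure lborel {t. set_coord x i t \<in> cylinder ?J K}"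
    proof (cases "S = {} \<or> emeasure lborel F = \<infinity>")
      case True then show ?thesis by (auto simp: S_def F_def)
    next
      case False
      then obtain f where f: "emeasure lborel F = ennreal f" "f \<ge> 0" "S \<noteq> {}"
        by (metis ennreal_cases infinity_ennreal_def)
      have "L * t \<le> f" if "t \<in> S" for t using S[OF that] f L by (simp add: ennreal_le_iff)
      then have "Sup S \<le> f / L" using f(3) L by (intro cSup_least) (auto simp: field_simps)
      moreover have "S \<subseteq> {0..Sup S}"
        using S by (auto intro!: cSup_upper bdd_aboveI[of _ 1])
      then have "emeasure lborel S \<le> emeasure lborel {0..Sup S}" by (intro emeasure_mono) auto
      moreover have "Sup S \<ge> 0" using \<open>S \<subseteq> {0..Sup S}\<close> f(3) by fastforce
      ultimately have "emeasure lborel S \<le> ennreal (f / L)"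
        by (simp add: order_trans ennreal_leI)
      then have "ennreal L * emeasure lborel S \<le> ennreal L * ennreal (f / L)" by (rule mult_left_mono) simp
      also have "\<dots> = ennreal f" using L f by (simp flip: ennreal_mult')
      finally show ?thesis using f by (simp add: S_def F_def)
    qed
  qed
  have "ennreal (L / real (Suc (card I)) * measure lebesgue (cylinder I K))
      = ennreal L * ennreal (measure lebesgue (cylinder I K) / real (Suc (card I)))"
    using L by (simp flip: ennreal_mult')
  also have "\<dots> \<le> ennreal L * emeasure lborel (cylinder ?J N)"
    unfolding N_def by (intro mult_left_mono measure_cylinder_cone K i) simp
  also have "\<dots> \<le> ennreal (measure lebesgue (cylinder ?J K))"
    using step by (simp only: emeasure_cylinder[OF K(1)])
  finally show ?thesis by (simp add: ennreal_le_iff)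
qed

lemma measure_cylinder_iterate:
  fixes K :: "(real^'d) set"
  assumes K: "compact K" "convex K" and L: "\<And>i. L i > 0" and fin: "finite J" and IJ: "I \<inter> J = {}"
    and ch: "\<And>i. i \<in> J \<Longrightarrow> \<exists>p\<in>K. \<exists>q\<in>K. q - p = axis i (L i)"
  shows "measure lebesgue (cylinder (I \<union> J) K) \<ge>
    (\<Prod>i\<in>J. L i) * fact (card I) / fact (card I + card J) * measure lebesgue (cylinder I K)"
  using fin IJ ch
proof (induction J rule: finite_induct)
  case (insert i J)
  let ?V = "\<lambda>J. measure lebesgue (cylinder (I \<union> J) K)"
  have iI: "i \<notin> I \<union> J" using insert by auto
  have c: "card (I \<union> J) = card I + card J"
    using insert by (intro card_Un_disjoint) auto
  obtain p q where pq: "p \<in> K" "q \<in> K" "q - p = axis i (L i)" using insert.prems(2)[of i] by auto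
  have "q $ j - p $ j = (if j = i then L i else 0)" for j
    using arg_cong[OF pq(3), of "\<lambda>v. v $ j"] by (simp add: axis_def)
  then have "\<And>j. j \<in> I \<union> J \<Longrightarrow> p $ j = q $ j" "q $ i - p $ i = L i"
    using iI by (metis eq_iff_diff_eq_0)+
  then have "?V (insert i J) \<ge> L i / real (Suc (card I + card J)) * ?V J"
    using measure_cylinder_insert[OF K iI pq(1,2) _ _ L] c by simp
  moreover have "L i / real (Suc (card I + card J)) * ?V J \<ge> L i / real (Suc (card I + card J)) *
      ((\<Prod>i\<in>J. L i) * fact (card I) / fact (card I + card J) * measure lebesgue (cylinder I K))"
    using insert L[of i] by (intro mult_left_mono) auto
  moreover have "L i / real (Suc (card I + card J)) *
      ((\<Prod>i\<in>J. L i) * fact (card I) / fact (card I + card J) * measure lebesgue (cylinder I K))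
    = (\<Prod>i\<in>insert i J. L i) * fact (card I) / fact (card I + card (insert i J)) * measure lebesgue (cylinder I K)"
    using insert by simp
  ultimately show ?case by linarith
qed simp

definition shadow :: "'d \<Rightarrow> 'd \<Rightarrow> real ^ 'd \<Rightarrow> real ^ 2" where
  "shadow a b x = vector [x $ a, x $ b]"

lemma shadow_nth [simp]: "shadow a b x $ 1 = x $ a" "shadow a b x $ 2 = x $ b"
  by (simp_all add: shadow_def)

lemma linear_shadow: "linear (shadow a b :: real^'d \<Rightarrow> real^2)"
  by (rule linearI) (simp_all add: vec_eq_iff forall_2)

lemma continuous_on_shadow: "continuous_on S (shadow a b :: real^'d \<Rightarrow> real^2)"
  by (simp add: linear_shadow linear_continuous_on linear_conv_bounded_linear[symmetric])

text \<open>
  As for a single coordinate: all coordinates but two are normalised to the unit interval.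
\<close>

lemma lborel_eq_distr_shadow:
  fixes a b :: "'d::finite"
  assumes ab: "a \<noteq> b"
  defines "Q \<equiv> {x::real^'d. \<forall>j\<in>-{a,b}. 0 < x $ j \<and> x $ j < 1}"
  shows "(lborel :: (real^2) measure) = distr (density lborel (indicator Q)) borel (shadow a b)"
proof (rule lborel_eqI)
  have "Q = (\<Inter>j\<in>-{a,b}. open_slab j)" by (auto simp: Q_def open_slab_def)
  then have Q: "Q \<in> sets lborel" by (simp add: borel_open open_INT open_open_slab)
  have sm: "shadow a b \<in> borel_measurable borel"
    by (intro borel_measurable_continuous_onI continuous_on_shadow)
  fix l u :: "real^2" assume le: "\<And>b. b \<in> Basis \<Longrightarrow> l \<bullet> b \<le> u \<bullet> b"
  have lu: "l $ j \<le> u $ j" for j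
    using le[of "axis j 1"] by (auto simp: Basis_vec_def inner_axis)
  define l' u' :: "real^'d" where "l' = (\<chi> j. if j = a then l $ 1 else if j = b then l $ 2 else 0)"
    and "u' = (\<chi> j. if j = a then u $ 1 else if j = b then u $ 2 else 1)"
  have eq: "Q \<inter> shadow a b -` box l u = box l' u'"
  proof (intro set_eqI iffI)
    fix x assume x: "x \<in> Q \<inter> shadow a b -` box l u"
    then show "x \<in> box l' u'"
      by (auto simp: mem_box_cart forall_2 Q_def l'_def u'_def)
  next
    fix x assume "x \<in> box l' u'"
    then have x: "l' $ j < x $ j \<and> x $ j < u' $ j" for j by (simp add: mem_box_cart)
    have "0 < x $ j \<and> x $ j < 1" if "j \<in> -{a,b}" for j
      using x[of j] that by (auto simp: l'_def u'_def)
    then show "x \<in> Q \<inter> shadow a b -` box l u"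
      using x[of a] x[of b] ab by (auto simp: mem_box_cart forall_2 Q_def l'_def u'_def)
  qed
  have "emeasure (distr (density lborel (indicator Q)) borel (shadow a b)) (box l u)
      = emeasure (density lborel (indicator Q)) (shadow a b -` box l u)"
    using sm by (subst emeasure_distr) auto
  also have "\<dots> = emeasure lborel (Q \<inter> shadow a b -` box l u)"
    using measurable_sets[OF sm, of "box l u"] Q by (subst emeasure_restricted) auto
  also have "\<dots> = ennreal (\<Prod>j\<in>UNIV. u' $ j - l' $ j)"
    unfolding eq using lu by (subst emeasure_box_cart) (auto simp: l'_def u'_def)
  also have "(\<Prod>j\<in>UNIV. u' $ j - l' $ j) = (\<Prod>j\<in>{a,b}. u' $ j - l' $ j)"
    by (rule prod.mono_neutral_right) (auto simp: l'_def u'_def)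
  also have "\<dots> = (\<Prod>j\<in>UNIV. (u - l) $ j)"
    using ab by (simp add: l'_def u'_def UNIV_2)
  finally show "emeasure (distr (density lborel (indicator Q)) borel (shadow a b)) (box l u)
      = ennreal (\<Prod>b\<in>Basis. (u - l) \<bullet> b)"
    by (simp add: box_cart_prod)
qed simp

lemma measure_cylinder_pair:
  fixes K :: "(real^'d) set"
  assumes K: "compact K" and ab: "a \<noteq> b"
  shows "measure lebesgue (cylinder {a,b} K) = measure lebesgue (shadow a b ` K)"
proof -
  define Q where "Q = {x::real^'d. \<forall>j\<in>-{a,b}. 0 < x $ j \<and> x $ j < 1}"
  have "Q = (\<Inter>j\<in>-{a,b}. open_slab j)" by (auto simp: Q_def open_slab_def)
  then have Q: "Q \<in> sets lborel" by (simp add: borel_open open_INT open_open_slab)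
  have sm: "shadow a b \<in> borel_measurable borel"
    by (intro borel_measurable_continuous_onI continuous_on_shadow)
  have cS: "compact (shadow a b ` K)" by (intro compact_continuous_image continuous_on_shadow K)
  then have Sb: "shadow a b ` K \<in> sets borel" by (simp add: compact_imp_closed borel_closed)
  have eq: "Q \<inter> shadow a b -` shadow a b ` K = cylinder {a,b} K"
    by (auto simp: Q_def cylinder_def vec_eq_iff forall_2)
  have "emeasure lborel (shadow a b ` K)
      = emeasure (density lborel (indicator Q)) (shadow a b -` shadow a b ` K)"
    unfolding lborel_eq_distr_shadow[OF ab] Q_def using sm Sb by (subst emeasure_distr) auto
  also have "\<dots> = emeasure lborel (Q \<inter> shadow a b -` shadow a b ` K)"
    using measurable_sets[OF sm Sb] Q by (subst emeasure_restricted) auto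
  finally have "emeasure lborel (shadow a b ` K) = emeasure lborel (cylinder {a,b} K)"
    by (simp only: eq)
  moreover have "measure lebesgue (shadow a b ` K) = measure lborel (shadow a b ` K)"
    using Sb by (intro measure_completion) simp
  moreover have "measure lebesgue (cylinder {a,b} K) = measure lborel (cylinder {a,b} K)"
    using cylinder_borel[OF K] by (intro measure_completion) simp
  ultimately show ?thesis by (simp add: measure_def)
qed

section \<open>The isodiametric inequality and Hausdorff measure\<close>

definition flip :: "'d \<Rightarrow> real ^ 'd \<Rightarrow> real ^ 'd" where
  "flip i x = (\<chi> j. if j = i then - x $ j else x $ j)"

lemma flip_nth [simp]: "flip i x $ j = (if j = i then - x $ j else x $ j)"
  by (simp add: flip_def)

lemma norm_flip: "norm (flip i x) = norm x"
  unfolding norm_vec_def by (intro L2_set_cong) auto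

text \<open>
  Steiner symmetrization in the \<open>i\<close>-th coordinate, for convex sets: a line in that direction meets \<open>C\<close> in a segment, and the
  halved differences of its points form the segment of equal length centred at zero. Writing the halved
  differences as means of a point and a reflected point makes compactness, convexity and the bound
  on the diameter immediate.
\<close>

definition steiner :: "'d \<Rightarrow> (real ^ 'd) set \<Rightarrow> (real ^ 'd) set" where
  "steiner i C = {(1/2) *\<^sub>R (p + flip i q) | p q. p \<in> C \<and> q \<in> C \<and> (\<forall>j. j \<noteq> i \<longrightarrow> p $ j = q $ j)}"

lemma steinerE:
  assumes "x \<in> steiner i C"
  obtains p q where "p \<in> C" "q \<in> C" "\<forall>j. j \<noteq> i \<longrightarrow> p $ j = q $ j" "x = (1/2) *\<^sub>R (p + flip i q)"
  using assms by (auto simp: steiner_def)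

lemma compact_steiner:
  assumes "compact C" shows "compact (steiner i (C :: (real^'d) set))"
proof -
  define P where "P = {z \<in> C \<times> C. \<forall>j. j \<noteq> i \<longrightarrow> fst z $ j = snd z $ j}"
  have "P = (C \<times> C) \<inter> (\<Inter>j\<in>-{i}. {z. fst z $ j = snd z $ j})" by (auto simp: P_def)
  moreover have "closed (\<Inter>j\<in>-{i}. {z :: (real^'d) \<times> (real^'d). fst z $ j = snd z $ j})"
    by (intro closed_INT ballI closed_Collect_eq continuous_intros)
  ultimately have "compact P"
    using assms by (simp add: compact_Times compact_Int_closed)
  moreover have "continuous_on P (\<lambda>z. (1/2) *\<^sub>R (fst z + flip i (snd z)))"
  proof -
    have "flip i x = set_coord x i (- (x $ i))" for x :: "real^'d" by (simp add: vec_eq_iff)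
    then show ?thesis by (auto intro!: continuous_intros)
  qed
  ultimately have "compact ((\<lambda>z. (1/2) *\<^sub>R (fst z + flip i (snd z))) ` P)"
    by (rule compact_continuous_image[rotated])
  moreover have "steiner i C = (\<lambda>z. (1/2) *\<^sub>R (fst z + flip i (snd z))) ` P"
    by (force simp: steiner_def P_def)
  ultimately show ?thesis by simp
qed

lemma convex_steiner:
  assumes "convex C" shows "convex (steiner i (C :: (real^'d) set))"
proof (rule convexI)
  fix x y :: "real^'d" and u v :: real
  assume x: "x \<in> steiner i C" and y: "y \<in> steiner i C" and uv: "0 \<le> u" "0 \<le> v" "u + v = 1"
  obtain p q where p: "p \<in> C" "q \<in> C" "\<forall>j. j \<noteq> i \<longrightarrow> p $ j = q $ j" "x = (1/2) *\<^sub>R (p + flip i q)"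
    using x by (rule steinerE)
  obtain p' q' where p': "p' \<in> C" "q' \<in> C" "\<forall>j. j \<noteq> i \<longrightarrow> p' $ j = q' $ j" "y = (1/2) *\<^sub>R (p' + flip i q')"
    using y by (rule steinerE)
  have "u *\<^sub>R p + v *\<^sub>R p' \<in> C" "u *\<^sub>R q + v *\<^sub>R q' \<in> C"
    using p p' uv assms by (auto intro: convexD)
  moreover have "u *\<^sub>R x + v *\<^sub>R y = (1/2) *\<^sub>R ((u *\<^sub>R p + v *\<^sub>R p') + flip i (u *\<^sub>R q + v *\<^sub>R q'))"
    by (simp add: p(4) p'(4) vec_eq_iff algebra_simps)
  moreover have "\<forall>j. j \<noteq> i \<longrightarrow> (u *\<^sub>R p + v *\<^sub>R p') $ j = (u *\<^sub>R q + v *\<^sub>R q') $ j"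
    using p(3) p'(3) by simp
  ultimately show "u *\<^sub>R x + v *\<^sub>R y \<in> steiner i C"
    unfolding steiner_def mem_Collect_eq by blast
qed

lemma emeasure_steiner_ge:
  fixes C :: "(real^'d) set"
  assumes C: "compact C" "convex C"
  shows "emeasure lborel C \<le> emeasure lborel (steiner i C)"
proof -
  have "1 * emeasure lborel C \<le> emeasure lborel (steiner i C)"
  proof (rule emeasure_fibre_mono)
    show "C \<in> sets borel" "steiner i C \<in> sets borel"
      using C compact_steiner by (auto intro!: borel_closed compact_imp_closed)
    fix x :: "real^'d"
    define A where "A = {t. set_coord x i t \<in> C}"
    have cs: "continuous_on UNIV (\<lambda>t. set_coord x i t)" by (intro continuous_intros)
    have clA: "closed A"
      using continuous_closed_vimage[of C "\<lambda>t. set_coord x i t"] C cs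
      by (auto simp: A_def vimage_def compact_imp_closed continuous_on_eq_continuous_at)
    obtain B where B: "\<And>z. z \<in> C \<Longrightarrow> norm z \<le> B"
      using C(1) by (metis compact_imp_bounded bounded_iff)
    have bA: "\<bar>t\<bar> \<le> B" if "t \<in> A" for t
      using component_le_norm_cart[of "set_coord x i t" i] B[of "set_coord x i t"] that
      by (simp add: A_def)
    show "1 * emeasure lborel {t. set_coord x i t \<in> C} \<le> emeasure lborel {t. set_coord x i t \<in> steiner i C}"
    proof (cases "A = {}")
      case False
      have "compact A" using clA bA by (auto simp: compact_eq_bounded_closed bounded_iff)
      then obtain m M where mM: "m \<in> A" "M \<in> A" "\<And>t. t \<in> A \<Longrightarrow> m \<le> t" "\<And>t. t \<in> A \<Longrightarrow> t \<le> M"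
        using False compact_attains_inf compact_attains_sup by metis
      have le: "m \<le> M" using mM by auto
      have full: "t \<in> A" if "m \<le> t" "t \<le> M" for t
      proof -
        have "convex A"
        proof (rule convexI)
          fix s t u v :: real assume st: "s \<in> A" "t \<in> A" and uv: "0 \<le> u" "0 \<le> v" "u + v = 1"
          have "set_coord x i (u *\<^sub>R s + v *\<^sub>R t) = u *\<^sub>R set_coord x i s + v *\<^sub>R set_coord x i t"
            using uv by (simp add: vec_eq_iff flip: distrib_right)
          then show "u *\<^sub>R s + v *\<^sub>R t \<in> A"
            using st convexD[OF C(2) _ _ uv] by (simp add: A_def)
        qed
        then have "is_interval A" by (simp add: is_interval_convex_1)
        then show ?thesis using mem_is_interval_1_I[OF _ mM(1,2) that] by blast
      qed
      have "emeasure lborel A \<le> emeasure lborel {m..M}" using mM by (intro emeasure_mono) auto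
      also have "\<dots> = emeasure lborel {- (M - m) / 2..(M - m) / 2}" using le by (simp add: field_simps)
      also have "\<dots> \<le> emeasure lborel {t. set_coord x i t \<in> steiner i C}"
      proof (rule emeasure_mono)
        show "{- (M - m) / 2..(M - m) / 2} \<subseteq> {t. set_coord x i t \<in> steiner i C}"
        proof
          fix \<tau> assume \<tau>: "\<tau> \<in> {- (M - m) / 2..(M - m) / 2}"
          have "(m + M) / 2 + \<tau> \<in> A" "(m + M) / 2 - \<tau> \<in> A"
            using \<tau> by (auto intro!: full simp: field_simps)
          moreover have "set_coord x i \<tau> = (1/2) *\<^sub>R (set_coord x i ((m + M) / 2 + \<tau>)
              + flip i (set_coord x i ((m + M) / 2 - \<tau>)))"
            by (simp add: vec_eq_iff field_simps)
          moreover have "\<forall>j. j \<noteq> i \<longrightarrow>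
              set_coord x i ((m + M) / 2 + \<tau>) $ j = set_coord x i ((m + M) / 2 - \<tau>) $ j" by simp
          ultimately show "\<tau> \<in> {t. set_coord x i t \<in> steiner i C}"
            unfolding steiner_def A_def mem_Collect_eq by blast
        qed
        have "closed {t. set_coord x i t \<in> steiner i C}"
          using continuous_closed_vimage[of "steiner i C" "\<lambda>t. set_coord x i t"] compact_steiner[OF C(1)] cs
          by (auto simp: vimage_def compact_imp_closed continuous_on_eq_continuous_at)
        then show "{t. set_coord x i t \<in> steiner i C} \<in> sets lborel" by simp
      qed
      finally show ?thesis by (simp add: A_def)
    qed (simp add: A_def)
  qed
  then show ?thesis by simp
qed

lemma dist_steiner_le:
  assumes "\<And>x y. x \<in> C \<Longrightarrow> y \<in> C \<Longrightarrow> dist x y \<le> D" and "x \<in> steiner i C" "y \<in> steiner i C"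
  shows "dist x y \<le> D"
proof -
  obtain p q where p: "p \<in> C" "q \<in> C" "x = (1/2) *\<^sub>R (p + flip i q)"
    using assms(2) steinerE by blast
  obtain p' q' where p': "p' \<in> C" "q' \<in> C" "y = (1/2) *\<^sub>R (p' + flip i q')"
    using assms(3) steinerE by blast
  have "x - y = (1/2) *\<^sub>R ((p - p') + flip i (q - q'))"
    by (simp add: p p' vec_eq_iff algebra_simps)
  then have "norm (x - y) \<le> (1/2) * (norm (p - p') + norm (flip i (q - q')))"
    using norm_triangle_ineq[of "p - p'" "flip i (q - q')"] by simp
  also have "\<dots> \<le> D" using assms(1)[OF p(1) p'(1)] assms(1)[OF p(2) p'(2)]
    by (simp add: norm_flip dist_norm)
  finally show ?thesis by (simp add: dist_norm)
qed

lemma flip_steiner: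
  assumes x: "x \<in> steiner i C" and "j = i \<or> (\<forall>y\<in>C. flip j y \<in> C)"
  shows "flip j x \<in> steiner i C"
proof -
  obtain p q where p: "p \<in> C" "q \<in> C" "\<forall>j. j \<noteq> i \<longrightarrow> p $ j = q $ j" "x = (1/2) *\<^sub>R (p + flip i q)"
    using x by (rule steinerE)
  show ?thesis
  proof (cases "j = i")
    case True
    have "flip j x = (1/2) *\<^sub>R (q + flip i p)"
      using True p(3) by (simp add: p(4) vec_eq_iff field_simps)
    moreover have "\<forall>k. k \<noteq> i \<longrightarrow> q $ k = p $ k" using p(3) by simp
    ultimately show ?thesis using p(1,2) unfolding steiner_def mem_Collect_eq by blast
  next
    case False
    have "flip j x = (1/2) *\<^sub>R (flip j p + flip i (flip j q))"
      using False by (simp add: p(4) vec_eq_iff field_simps)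
    moreover have "flip j p \<in> C" "flip j q \<in> C" using assms(2) False p by auto
    moreover have "\<forall>k. k \<noteq> i \<longrightarrow> flip j p $ k = flip j q $ k" using p(3) by simp
    ultimately show ?thesis unfolding steiner_def mem_Collect_eq by blast
  qed
qed

text \<open>
  Later symmetrizations preserve the reflections that were gained by earlier ones.
\<close>

lemma steiner_symmetrization:
  fixes C :: "(real^'d) set"
  assumes C: "compact C" "convex C" and D: "\<And>x y. x \<in> C \<Longrightarrow> y \<in> C \<Longrightarrow> dist x y \<le> D"
    and "finite J"
  shows "\<exists>C' :: (real^'d) set. compact C' \<and> convex C' \<and> emeasure lborel C \<le> emeasure lborel C' \<and>
    (\<forall>x\<in>C'. \<forall>y\<in>C'. dist x y \<le> D) \<and> (\<forall>i\<in>J. \<forall>x\<in>C'. flip i x \<in> C')"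
  using \<open>finite J\<close>
proof (induction J rule: finite_induct)
  case empty
  show ?case by (rule exI[of _ C]) (simp add: C D)
next
  case (insert i J)
  then obtain C' :: "(real^'d) set" where C': "compact C'" "convex C'" "emeasure lborel C \<le> emeasure lborel C'"
    "\<forall>x\<in>C'. \<forall>y\<in>C'. dist x y \<le> D" "\<forall>i\<in>J. \<forall>x\<in>C'. flip i x \<in> C'" by blast
  show ?case
  proof (intro exI[of _ "steiner i C'"] conjI ballI)
    show "emeasure lborel C \<le> emeasure lborel (steiner i C')"
      using C' emeasure_steiner_ge order_trans by blast
    show "dist x y \<le> D" if "x \<in> steiner i C'" "y \<in> steiner i C'" for x y
      using dist_steiner_le[of C' D, OF _ that] C'(4) by blast
    show "flip j x \<in> steiner i C'" if "j \<in> insert i J" "x \<in> steiner i C'" for j x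
      using flip_steiner[OF that(2)] that(1) C'(5) by blast
  qed (rule compact_steiner[OF C'(1)] convex_steiner[OF C'(2)])+
qed

text \<open>
  After symmetrization in all coordinates the set is symmetric about the origin, so that every point has
  at most half the diameter as its norm.
\<close>

lemma isodiametric:
  fixes C :: "(real^'d) set"
  assumes C: "compact C" "convex C" "C \<noteq> {}"
  shows "emeasure lborel C \<le> ennreal (unit_ball_vol (real CARD('d)) * (diameter C / 2) ^ CARD('d))"
proof -
  have bC: "bounded C" using C by (simp add: compact_imp_bounded)
  obtain C' :: "(real^'d) set" where C': "emeasure lborel C \<le> emeasure lborel C'"
    "\<forall>x\<in>C'. \<forall>y\<in>C'. dist x y \<le> diameter C" "\<forall>i\<in>UNIV. \<forall>x\<in>C'. flip i x \<in> C'"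
    using steiner_symmetrization[OF C(1,2), of "diameter C" UNIV] diameter_bounded_bound[OF bC] by auto
  have sym: "(\<chi> j. if j \<in> J then - x $ j else x $ j) \<in> C'" if "x \<in> C'" "finite J" for x J
    using that(2)
  proof (induction J rule: finite_induct)
    case (insert i J)
    have "flip i (\<chi> j. if j \<in> J then - x $ j else x $ j) = (\<chi> j. if j \<in> insert i J then - x $ j else x $ j)"
      using insert(2) by (simp add: vec_eq_iff)
    then show ?case using insert(3) C'(3) by (metis UNIV_I)
  qed (use that in simp)
  have "C' \<subseteq> cball 0 (diameter C / 2)"
  proof
    fix x assume x: "x \<in> C'"
    have "- x = (\<chi> j. if j \<in> UNIV then - x $ j else x $ j)" by (simp add: vec_eq_iff)
    then have "- x \<in> C'" using sym[OF x, of UNIV] by simp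
    then have "dist x (- x) \<le> diameter C" using C'(2) x by blast
    moreover have "dist x (- x) = 2 * norm x"
      by (simp add: dist_norm flip: scaleR_2)
    ultimately show "x \<in> cball 0 (diameter C / 2)" by simp
  qed
  then have "emeasure lborel C' \<le> emeasure lborel (cball (0::real^'d) (diameter C / 2))"
    by (intro emeasure_mono) auto
  also have "\<dots> = ennreal (unit_ball_vol (real CARD('d)) * (diameter C / 2) ^ CARD('d))"
    using diameter_ge_0[OF bC] by (subst emeasure_cball) auto
  finally show ?thesis using C'(1) by order
qed

lemma diameter_convex_hull:
  fixes S :: "'a::real_normed_vector set"
  assumes S: "bounded S"
  shows "diameter (convex hull S) = diameter S"
proof (rule antisym)
  show "diameter S \<le> diameter (convex hull S)"
    by (intro diameter_subset hull_subset bounded_convex_hull S)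
  have 1: "convex hull S \<subseteq> cball y (diameter S)" if "y \<in> S" for y
    using diameter_bounded_bound[OF S that] by (intro hull_minimal) auto
  have 2: "convex hull S \<subseteq> cball z (diameter S)" if "z \<in> convex hull S" for z
    using subsetD[OF 1 that] by (intro hull_minimal) (auto simp: dist_commute[of z])
  show "diameter (convex hull S) \<le> diameter S"
  proof (rule diameter_le)
    show "convex hull S \<noteq> {} \<or> 0 \<le> diameter S" by (simp add: diameter_ge_0 S)
    show "norm (x - y) \<le> diameter S" if "x \<in> convex hull S" "y \<in> convex hull S" for x y
      unfolding dist_norm[symmetric] using 2[OF that(1)] that(2) by auto
  qed
qed

text \<open>
  The sets of a cover may be replaced by their closed convex hulls, which have the same diameters and to
  which the isodiametric inequality applies.
\<close>

lemma lborel_le_hausdorff_measure: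
  fixes A :: "(real^'d) set"
  shows "emeasure lborel A \<le> hausdorff_measure CARD('d) A"
proof -
  \<comment> \<open>The isodiametric inequality holds at every scale, so any bound on the diameters of the cover will do.\<close>
  have "emeasure lborel A \<le> hausdorff_premeasure CARD('d) 1 A"
    unfolding hausdorff_premeasure_def
  proof (rule INF_greatest)
    fix C :: "nat \<Rightarrow> (real^'d) set"
    assume "C \<in> {C. A \<subseteq> (\<Union>i. C i) \<and> (\<forall>i. bounded (C i) \<and> diameter (C i) \<le> 1)}"
    then have C: "A \<subseteq> (\<Union>i. C i)" "\<And>i. bounded (C i)" by auto
    define H where "H = (\<lambda>i. closure (convex hull (C i)))"
    have H: "compact (H i)" "convex (H i)" "C i \<subseteq> H i" for i
      using C(2)[of i] closure_subset[of "convex hull (C i)"] hull_subset[of "C i" convex]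
      by (auto simp: H_def compact_closure bounded_convex_hull convex_closure)
    have Hb: "H i \<in> sets lborel" for i
      using H(1)[of i] by (simp add: borel_closed compact_imp_closed)
    have "(\<Union>i. C i) \<subseteq> (\<Union>i. H i)" using H(3) by blast
    then have "emeasure lborel A \<le> emeasure lborel (\<Union>i. H i)"
      using C(1) Hb by (intro emeasure_mono sets.countable_UN) auto
    also have "\<dots> \<le> (\<Sum>i. emeasure lborel (H i))"
      using Hb by (intro emeasure_subadditive_countably) auto
    also have "\<dots> \<le> (\<Sum>i. hausdorff_gauge CARD('d) (C i))"
    proof (intro suminf_le)
      fix i
      show "emeasure lborel (H i) \<le> hausdorff_gauge CARD('d) (C i)"
      proof (cases "C i = {}")
        case False
        then have "H i \<noteq> {}" using H(3) by auto
        moreover have "diameter (H i) = diameter (C i)"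
          unfolding H_def using C(2) by (simp add: diameter_closure bounded_convex_hull diameter_convex_hull)
        ultimately show ?thesis using isodiametric[OF H(1,2)[of i]] False by (simp add: hausdorff_gauge_def)
      qed (simp add: H_def)
    qed auto
    finally show "emeasure lborel A \<le> (\<Sum>i. hausdorff_gauge CARD('d) (C i))" .
  qed
  also have "\<dots> \<le> hausdorff_measure CARD('d) A"
    unfolding hausdorff_measure_def by (rule SUP_upper) simp
  finally show ?thesis .
qed

lemma hausdorff_measure_nonexpansive_image:
  fixes f :: "'a::metric_space \<Rightarrow> 'b::real_normed_vector"
  assumes f: "\<And>x y. dist (f x) (f y) \<le> dist x y"
  shows "hausdorff_measure d (f ` A) \<le> hausdorff_measure d A"
proof -
  have dia: "bounded (f ` S) \<and> diameter (f ` S) \<le> diameter S" if S: "bounded S" for S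
  proof
    have le: "dist x y \<le> diameter S" if "x \<in> f ` S" "y \<in> f ` S" for x y
      using that order_trans[OF f diameter_bounded_bound[OF S]] by blast
    then show "bounded (f ` S)" unfolding bounded_two_points by blast
    show "diameter (f ` S) \<le> diameter S"
      using le diameter_ge_0[OF S] by (intro diameter_le) (auto simp: dist_norm)
  qed
  have "hausdorff_premeasure d \<delta> (f ` A) \<le> hausdorff_premeasure d \<delta> A" for \<delta>
    unfolding hausdorff_premeasure_def
  proof (rule INF_mono)
    fix C assume "C \<in> {C :: nat \<Rightarrow> 'a set. A \<subseteq> (\<Union>i. C i) \<and> (\<forall>i. bounded (C i) \<and> diameter (C i) \<le> \<delta>)}"
    then have C: "A \<subseteq> (\<Union>i. C i)" "\<And>i. bounded (C i)" "\<And>i. diameter (C i) \<le> \<delta>" by auto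
    have "hausdorff_gauge d (f ` C i) \<le> hausdorff_gauge d (C i)" for i
      using dia[OF C(2)] diameter_ge_0[of "f ` C i"]
      by (auto simp: hausdorff_gauge_def intro!: ennreal_leI mult_left_mono power_mono)
    then have "(\<Sum>i. hausdorff_gauge d (f ` C i)) \<le> (\<Sum>i. hausdorff_gauge d (C i))"
      by (intro suminf_le) auto
    moreover have "(\<lambda>i. f ` C i) \<in> {C. f ` A \<subseteq> (\<Union>i. C i) \<and> (\<forall>i. bounded (C i) \<and> diameter (C i) \<le> \<delta>)}"
    proof -
      have "f ` A \<subseteq> (\<Union>i. f ` C i)" using image_mono[OF C(1), of f] by (simp add: image_UN)
      moreover have "diameter (f ` C i) \<le> \<delta>" for i
        using dia[OF C(2), of i] C(3)[of i] by linarith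
      ultimately show ?thesis using dia[OF C(2)] by simp
    qed
    ultimately show "\<exists>C'\<in>{C. f ` A \<subseteq> (\<Union>i. C i) \<and> (\<forall>i. bounded (C i) \<and> diameter (C i) \<le> \<delta>)}.
        (\<Sum>i. hausdorff_gauge d (C' i)) \<le> (\<Sum>i. hausdorff_gauge d (C i))"
      by (intro bexI[of _ "\<lambda>i. f ` C i"]) auto
  qed
  then show ?thesis unfolding hausdorff_measure_def by (intro SUP_mono) auto
qed

section \<open>Intrinsic distances on an equilateral triangle\<close>

lemma path_length_le_lipschitz:
  fixes g :: "real \<Rightarrow> 'a::metric_space"
  assumes g: "L-lipschitz_on {0..1} g"
  shows "path_length g \<le> ennreal L"
  unfolding path_length_def
proof (rule SUP_least, clarify)
  fix N and t :: "nat \<Rightarrow> real" assume mono: "mono_on {..N} t" and t: "t ` {..N} \<subseteq> {0..1}"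
  have L: "L \<ge> 0" using g by (rule lipschitz_on_nonneg)
  have t01: "t i \<in> {0..1}" if "i \<le> N" for i using t that by (auto simp: image_subset_iff)
  have le: "dist (g (t i)) (g (t (Suc i))) \<le> L * (t (Suc i) - t i)" if "i < N" for i
  proof -
    have "t i \<le> t (Suc i)" using that by (intro mono_onD[OF mono]) auto
    moreover have "t i \<in> {0..1}" "t (Suc i) \<in> {0..1}" using t01 that by auto
    ultimately show ?thesis using lipschitz_onD[OF g, of "t i" "t (Suc i)"] by (simp add: dist_real_def)
  qed
  have "(\<Sum>i<N. ennreal (dist (g (t i)) (g (t (Suc i))))) = ennreal (\<Sum>i<N. dist (g (t i)) (g (t (Suc i))))"
    by (simp add: sum_ennreal)
  also have "(\<Sum>i<N. dist (g (t i)) (g (t (Suc i)))) \<le> (\<Sum>i<N. L * (t (Suc i) - t i))"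
    using le by (intro sum_mono) auto
  also have "\<dots> = L * (t N - t 0)" by (simp add: sum_lessThan_telescope flip: sum_distrib_left)
  also have "\<dots> \<le> L * 1" using t01[of 0] t01[of N] L by (intro mult_left_mono) auto
  finally show "(\<Sum>i<N. ennreal (dist (g (t i)) (g (t (Suc i))))) \<le> ennreal L" by (simp add: ennreal_leI)
qed

text \<open>
  Upper bounds for intrinsic distances only need Lipschitz paths, whose lengths are estimated without
  partitions when paths are concatenated.
\<close>

definition lipschitz_joined :: "'a::metric_space set \<Rightarrow> real \<Rightarrow> 'a \<Rightarrow> 'a \<Rightarrow> bool" where
  "lipschitz_joined M L x y \<longleftrightarrow> (\<exists>g :: real \<Rightarrow> 'a. L-lipschitz_on {0..1} g \<and> g ` {0..1} \<subseteq> M \<and> g 0 = x \<and> g 1 = y)"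

lemma intrinsic_dist_le:
  fixes x y :: "'a::metric_space"
  assumes "lipschitz_joined M L x y" shows "intrinsic_dist M x y \<le> ennreal L"
proof -
  obtain g :: "real \<Rightarrow> 'a" where g: "L-lipschitz_on {0..1} g" "g ` {0..1} \<subseteq> M" "g 0 = x" "g 1 = y"
    using assms by (auto simp: lipschitz_joined_def)
  have "intrinsic_dist M x y \<le> path_length g"
    unfolding intrinsic_dist_def
    by (rule INF_lower)
       (use g lipschitz_on_continuous_on[OF g(1)] in \<open>auto simp: path_def path_image_def pathstart_def pathfinish_def\<close>)
  also have "\<dots> \<le> ennreal L" by (rule path_length_le_lipschitz[OF g(1)])
  finally show ?thesis .
qed

lemma lipschitz_joined_segment:
  fixes x y :: "'a::real_normed_vector"
  assumes "closed_segment x y \<subseteq> M"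
  shows "lipschitz_joined M (dist x y) x y"
  unfolding lipschitz_joined_def
proof (intro exI[of _ "linepath x y"] conjI)
  show "(dist x y)-lipschitz_on {0..1} (linepath x y)"
  proof (rule lipschitz_onI)
    fix s t :: real
    have "linepath x y s - linepath x y t = (s - t) *\<^sub>R (y - x)"
      by (simp add: linepath_def algebra_simps)
    then show "dist (linepath x y s) (linepath x y t) \<le> dist x y * dist s t"
      by (simp add: dist_norm norm_minus_commute mult.commute)
  qed simp
qed (use assms in \<open>simp_all add: linepath_image_01 linepath_0' linepath_1'\<close>)

lemma lipschitz_joined_trans:
  fixes x y z :: "'a::metric_space"
  assumes 1: "lipschitz_joined M L1 x y" and 2: "lipschitz_joined M L2 y z"
  shows "lipschitz_joined M (L1 + L2) x z"
proof -
  obtain g :: "real \<Rightarrow> 'a" where g: "L1-lipschitz_on {0..1} g" "g ` {0..1} \<subseteq> M" "g 0 = x" "g 1 = y"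
    using 1 by (auto simp: lipschitz_joined_def)
  obtain h :: "real \<Rightarrow> 'a" where h: "L2-lipschitz_on {0..1} h" "h ` {0..1} \<subseteq> M" "h 0 = y" "h 1 = z"
    using 2 by (auto simp: lipschitz_joined_def)
  have nn: "L1 \<ge> 0" "L2 \<ge> 0" using g h lipschitz_on_nonneg by auto
  consider "L1 = 0" | "L2 = 0" | "L1 > 0" "L2 > 0" using nn by linarith
  then show ?thesis
  proof cases
    case 1
    then have "dist (g 0) (g 1) \<le> 0" using lipschitz_onD[OF g(1), of 0 1] by simp
    then show ?thesis using 1 g(3,4) \<open>lipschitz_joined M L2 y z\<close> by simp
  next
    case 2
    then have "dist (h 0) (h 1) \<le> 0" using lipschitz_onD[OF h(1), of 0 1] by simp
    then show ?thesis using 2 h(3,4) \<open>lipschitz_joined M L1 x y\<close> by simp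
  next
    case 3
    \<comment> \<open>Time is divided in proportion to the constants, so both halves become \<open>(L1 + L2)\<close>-Lipschitz.\<close>
    define l where "l = L1 / (L1 + L2)"
    have l: "0 < l" "l < 1" "L1 / l = L1 + L2" "L2 / (1 - l) = L1 + L2"
      using 3 by (auto simp: l_def field_simps)
    define k where "k = (\<lambda>t. if t \<le> l then g (t / l) else h ((t - l) / (1 - l)))"
    have "(L1 + L2)-lipschitz_on {0..l} (\<lambda>t. g (t / l))"
    proof (rule lipschitz_onI)
      fix s t assume "s \<in> {0..l}" "t \<in> {0..l}"
      then have "dist (g (s / l)) (g (t / l)) \<le> L1 * dist (s / l) (t / l)"
        using l by (intro lipschitz_onD[OF g(1)]) auto
      also have "dist (s / l) (t / l) = dist s t / l"
        using l by (simp add: dist_real_def flip: diff_divide_distrib)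
      also have "L1 * (dist s t / l) = L1 / l * dist s t" by simp
      finally show "dist (g (s / l)) (g (t / l)) \<le> (L1 + L2) * dist s t"
        unfolding l(3) .
    qed (use nn in simp)
    moreover have "(L1 + L2)-lipschitz_on {l..1} (\<lambda>t. h ((t - l) / (1 - l)))"
    proof (rule lipschitz_onI)
      fix s t assume "s \<in> {l..1}" "t \<in> {l..1}"
      then have "dist (h ((s - l) / (1 - l))) (h ((t - l) / (1 - l)))
          \<le> L2 * dist ((s - l) / (1 - l)) ((t - l) / (1 - l))"
        using l by (intro lipschitz_onD[OF h(1)]) auto
      also have "dist ((s - l) / (1 - l)) ((t - l) / (1 - l)) = dist s t / (1 - l)"
        using l by (simp add: dist_real_def flip: diff_divide_distrib)
      also have "L2 * (dist s t / (1 - l)) = L2 / (1 - l) * dist s t" by simp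
      finally show "dist (h ((s - l) / (1 - l))) (h ((t - l) / (1 - l))) \<le> (L1 + L2) * dist s t"
        unfolding l(4) .
    qed (use nn in simp)
    ultimately have "(L1 + L2)-lipschitz_on {0..1} k"
      unfolding k_def using l g h by (intro lipschitz_on_concat) auto
    moreover have "k t \<in> M" if "t \<in> {0..1}" for t
    proof (cases "t \<le> l")
      case True
      then have "t / l \<in> {0..1}" using l that by auto
      then show ?thesis using True g(2) by (auto simp: k_def)
    next
      case False
      then have "(t - l) / (1 - l) \<in> {0..1}" using l that by auto
      then show ?thesis using False h(2) by (auto simp: k_def)
    qed
    moreover have "k 0 = x" "k 1 = z" using l g h by (auto simp: k_def)
    ultimately show ?thesis unfolding lipschitz_joined_def by blast
  qed
qed

lemma path_length_ge_via:
  assumes t: "t \<in> {0..1}"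
  shows "ennreal (dist (g 0) (g t) + dist (g t) (g 1)) \<le> path_length g"
proof -
  define p where "p = (\<lambda>i::nat. if i = 0 then 0 else if i = 1 then t else (1::real))"
  have "mono_on {..2} p" "p ` {..2} \<subseteq> {0..1}"
    using t by (auto simp: p_def mono_on_def)
  then have "(\<Sum>i<2. ennreal (dist (g (p i)) (g (p (Suc i))))) \<le> path_length g"
    unfolding path_length_def by (intro SUP_upper2[of "(2, p)"]) auto
  then show ?thesis by (simp add: numeral_2_eq_2 p_def)
qed

locale equilateral_triangle =
  fixes A B C :: "'a::euclidean_space" and s :: real
  assumes dim2: "DIM('a) = 2" and s: "s > 0"
    and sides: "dist A B = s" "dist B C = s" "dist C A = s"
begin

definition "T = frontier (convex hull {A, B, C})"
definition "foot = (1/2) *\<^sub>R (B + C)"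
definition "height = sqrt 3 / 2 * s"
definition "u = (1 / height) *\<^sub>R (A - foot)"

lemma T_eq: "T = closed_segment A B \<union> closed_segment B C \<union> closed_segment C A"
  unfolding T_def by (rule frontier_of_triangle[OF dim2])

lemma inners: "(B - A) \<bullet> (B - A) = s\<^sup>2" "(C - A) \<bullet> (C - A) = s\<^sup>2" "(B - A) \<bullet> (C - A) = s\<^sup>2 / 2"
proof -
  show 1: "(B - A) \<bullet> (B - A) = s\<^sup>2" "(C - A) \<bullet> (C - A) = s\<^sup>2"
    using sides by (simp_all add: dist_norm norm_minus_commute flip: power2_norm_eq_inner)
  have "(C - B) \<bullet> (C - B) = s\<^sup>2"
    using sides by (simp add: dist_norm norm_minus_commute flip: power2_norm_eq_inner)
  then show "(B - A) \<bullet> (C - A) = s\<^sup>2 / 2"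
    using 1 by (simp add: inner_diff_left inner_diff_right inner_commute)
qed

lemma height_pos: "height > 0" and height_sq: "height * height = 3/4 * s\<^sup>2"
  using s by (simp_all add: height_def power2_eq_square)

lemma A_foot: "A - foot = - (1/2) *\<^sub>R ((B - A) + (C - A))"
proof -
  have "A = (1/2) *\<^sub>R A + (1/2) *\<^sub>R A" by (simp flip: scaleR_left_distrib)
  then show ?thesis unfolding foot_def by (simp add: algebra_simps)
qed

lemma foot_side: "foot - B = (1/2) *\<^sub>R (C - B)" "foot - C = (1/2) *\<^sub>R (B - C)"
proof -
  have "X = (1/2) *\<^sub>R X + (1/2) *\<^sub>R X" for X :: 'a by (simp flip: scaleR_left_distrib)
  from this[of B] this[of C] show "foot - B = (1/2) *\<^sub>R (C - B)" "foot - C = (1/2) *\<^sub>R (B - C)"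
    unfolding foot_def by (simp_all add: algebra_simps)
qed

lemma norm_u: "norm u = 1" and A_foot_u: "A - foot = height *\<^sub>R u"
proof -
  have "(A - foot) \<bullet> (A - foot) = height * height"
    unfolding A_foot height_sq using inners
    by (simp add: inner_add_left inner_add_right inner_commute)
  then have "norm (A - foot) = height"
    using height_pos by (simp add: norm_eq_sqrt_inner)
  then show "norm u = 1" "A - foot = height *\<^sub>R u" using height_pos by (simp_all add: u_def)
qed

lemma u_level: "(A - foot) \<bullet> u = height" "(B - foot) \<bullet> u = 0" "(C - foot) \<bullet> u = 0"
proof -
  show "(A - foot) \<bullet> u = height" using norm_u by (simp add: A_foot_u dot_square_norm)
  have "(C - B) \<bullet> (A - foot) = 0"
    unfolding A_foot using inners by (simp add: inner_diff_left inner_diff_right inner_add_left inner_add_right inner_commute)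
  then have "(foot - B) \<bullet> u = 0" "(foot - C) \<bullet> u = 0"
    unfolding foot_side u_def by (simp_all add: inner_diff_left)
  then show "(B - foot) \<bullet> u = 0" "(C - foot) \<bullet> u = 0" by (simp_all add: inner_diff_left)
qed

text \<open>
  The height above the side \<open>BC\<close> is \<open>height\<close> times the barycentric coordinate of \<open>A\<close>, so a difference of heights
  that reaches \<open>height\<close> occurs only between \<open>A\<close> and the side \<open>BC\<close>.
\<close>

lemma vertical_chord:
  assumes x: "x \<in> T" "y \<in> T" and y: "y - x = c *\<^sub>R u" and c: "\<bar>c\<bar> \<ge> height"
  shows "x = A \<and> y = foot \<or> x = foot \<and> y = A"
proof -
  have cl: "compact (convex hull {A,B,C})" by (simp add: finite_imp_compact_convex_hull)
  then have sub: "T \<subseteq> convex hull {A,B,C}"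
    unfolding T_def by (simp add: compact_imp_closed frontier_subset_closed)
  have bary: "\<exists>a\<in>{0..1}. (z - foot) \<bullet> u = a * height \<and> (a = 1 \<longrightarrow> z = A)" if z: "z \<in> T" for z
  proof -
    obtain a b d where abd: "0 \<le> a" "0 \<le> b" "0 \<le> d" "a + b + d = 1" "z = a *\<^sub>R A + b *\<^sub>R B + d *\<^sub>R C"
      using subsetD[OF sub z] unfolding convex_hull_3 by blast
    have "z - foot = a *\<^sub>R (A - foot) + b *\<^sub>R (B - foot) + d *\<^sub>R (C - foot)"
    proof -
      have "foot = (a + b + d) *\<^sub>R foot" by (simp add: abd)
      then show ?thesis by (simp add: abd(5) algebra_simps)
    qed
    then have "(z - foot) \<bullet> u = a * height" using u_level by (simp add: inner_add_left)
    moreover have "a = 1 \<longrightarrow> z = A"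
    proof
      assume "a = 1" then have "b = 0" "d = 0" using abd(2-4) by auto
      then show "z = A" using abd(5) \<open>a = 1\<close> by simp
    qed
    ultimately show ?thesis using abd by (intro bexI[of _ a]) auto
  qed
  obtain a where a: "0 \<le> a" "a \<le> 1" "(x - foot) \<bullet> u = a * height" "a = 1 \<longrightarrow> x = A"
    using bary[OF x(1)] by auto
  obtain b where b: "0 \<le> b" "b \<le> 1" "(y - foot) \<bullet> u = b * height" "b = 1 \<longrightarrow> y = A"
    using bary[OF x(2)] by auto
  have "(y - x) \<bullet> u = (b - a) * height"
    using a b by (simp add: inner_diff_left algebra_simps)
  then have cab: "c = (b - a) * height" using norm_u by (simp add: y dot_square_norm)
  then have "\<bar>b - a\<bar> * height \<ge> 1 * height" using c height_pos by (simp add: abs_mult)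
  then have "\<bar>b - a\<bar> \<ge> 1" using height_pos by simp
  then consider "a = 1" "b = 0" | "a = 0" "b = 1" using a b by linarith
  then show ?thesis
  proof cases
    case 1
    then have "x = A" using a by simp
    then have "y - A = - (A - foot)" unfolding A_foot_u using 1 y cab by simp
    then show ?thesis using \<open>x = A\<close> by simp
  next
    case 2
    then have "y = A" using b by simp
    then have "A - x = A - foot" unfolding A_foot_u using 2 y cab by simp
    then show ?thesis using \<open>y = A\<close> by simp
  qed
qed

text \<open>
  The side \<open>BC\<close> and the union of the other two sides are closed and meet only in \<open>B\<close> and \<open>C\<close>, so by
  connectedness each path from the one to the other passes through one of these vertices.
\<close>

lemma intrinsic_dist_vertex_foot:
  assumes xy: "x = A \<and> y = foot \<or> x = foot \<and> y = A"
  shows "intrinsic_dist T x y \<ge> ennreal (3 / 2 * s)"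
  unfolding intrinsic_dist_def
proof (rule INF_greatest)
  fix g assume "g \<in> {g. path g \<and> path_image g \<subseteq> T \<and> pathstart g = x \<and> pathfinish g = y}"
  then have g: "path g" "path_image g \<subseteq> T" "g 0 = x" "g 1 = y"
    by (auto simp: pathstart_def pathfinish_def)
  let ?S1 = "closed_segment A B \<union> closed_segment C A" and ?S2 = "closed_segment B C"
  have g01: "g 0 \<in> path_image g" "g 1 \<in> path_image g" by (auto simp: path_image_def)
  have foot: "foot \<in> ?S2" "A \<in> ?S1"
    using midpoint_in_closed_segment[of B C] by (simp_all add: foot_def midpoint_def)
  have "connected (path_image g)" using g(1) by (rule connected_path_image)
  moreover have "closed ?S1" "closed ?S2" by (auto intro: closed_Un)
  moreover have "path_image g \<subseteq> ?S1 \<union> ?S2" using g(2) by (auto simp: T_eq)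
  moreover have "?S1 \<inter> path_image g \<noteq> {}" "?S2 \<inter> path_image g \<noteq> {}"
    using xy g g01 foot by auto
  ultimately have "?S1 \<inter> ?S2 \<inter> path_image g \<noteq> {}"
    unfolding connected_closed by blast
  then obtain z where z: "z \<in> ?S1" "z \<in> ?S2" "z \<in> path_image g" by auto
  have lev: "(((1 - t) *\<^sub>R X + t *\<^sub>R Y) - foot) \<bullet> u = (1 - t) * ((X - foot) \<bullet> u) + t * ((Y - foot) \<bullet> u)" for X Y t
    by (simp add: inner_diff_left inner_add_left algebra_simps)
  have z0: "(z - foot) \<bullet> u = 0"
    using z(2) lev[of _ B C] u_level by (auto simp: closed_segment_def)
  have "z = B \<or> z = C"
    using z(1)
  proof
    assume "z \<in> closed_segment A B"
    then obtain t where t: "z = (1 - t) *\<^sub>R A + t *\<^sub>R B" by (auto simp: closed_segment_def)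
    then have "(1 - t) * height = 0" using z0 lev[of t A B] u_level by simp
    then show ?thesis using t height_pos by simp
  next
    assume "z \<in> closed_segment C A"
    then obtain t where t: "z = (1 - t) *\<^sub>R C + t *\<^sub>R A" by (auto simp: closed_segment_def)
    then have "t * height = 0" using z0 lev[of t C A] u_level by simp
    then show ?thesis using t height_pos by simp
  qed
  moreover have "dist A B = s" "dist A C = s" "dist foot B = s / 2" "dist foot C = s / 2"
    using sides s foot_side by (auto simp: dist_norm norm_minus_commute)
  ultimately have len: "dist x z + dist z y = 3 / 2 * s"
    using xy by (auto simp: dist_commute)
  obtain t where t: "t \<in> {0..1}" "z = g t" using z(3) by (auto simp: path_image_def)
  show "ennreal (3 / 2 * s) \<le> path_length g"
    using path_length_ge_via[OF t(1), of g] unfolding t(2)[symmetric] g(3,4) len .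
qed

text \<open>
  The only point of the triangle at half the perimeter from the quarter point lies at three quarters of the
  side \<open>BC\<close>, at Euclidean distance \<open>3/4 * s\<close>, which is less than the height. Every other point is reached by a shorter
  way through one vertex or two.
\<close>

lemma intrinsic_dist_quarter_point:
  assumes y: "y \<in> T" "norm (y - (A + (1/4) *\<^sub>R (B - A))) \<ge> height"
  shows "intrinsic_dist T (A + (1/4) *\<^sub>R (B - A)) y < ennreal (3 / 2 * s)"
proof -
  define x where "x = A + (1/4) *\<^sub>R (B - A)"
  have q: "(1/4) *\<^sub>R X + (3/4) *\<^sub>R X = X" for X :: 'a by (simp flip: scaleR_left_distrib)
  have xA: "x = (1 - 1/4) *\<^sub>R A + (1/4) *\<^sub>R B"
    unfolding x_def using q[of A] by (simp add: algebra_simps)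
  have x_in: "x \<in> closed_segment A B"
    unfolding xA closed_segment_def by (auto intro!: exI[of _ "1/4"])
  have sub: "closed_segment A B \<subseteq> T" "closed_segment B C \<subseteq> T" "closed_segment C A \<subseteq> T"
    by (auto simp: T_eq)
  have seg: "closed_segment p q \<subseteq> T"
    if "p \<in> closed_segment X Y" "q \<in> closed_segment X Y" "closed_segment X Y \<subseteq> T" for p q X Y
    using that closed_segment_subset[OF that(1,2)] by auto
  have join: "lipschitz_joined T (dist p q) p q"
    if "p \<in> closed_segment X Y" "q \<in> closed_segment X Y" "closed_segment X Y \<subseteq> T" for p q X Y
    by (rule lipschitz_joined_segment[OF seg[OF that]])
  have xAd: "dist x A = s / 4" using sides by (simp add: x_def dist_norm norm_minus_commute)
  have "B - x = (3/4) *\<^sub>R (B - A)"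
    unfolding xA using q[of B] by (simp add: algebra_simps)
  then have xBd: "dist x B = 3 / 4 * s" using sides by (simp add: dist_norm norm_minus_commute)
  have "\<exists>L. lipschitz_joined T L x y \<and> 0 \<le> L \<and> L < 3 / 2 * s"
  proof -
    consider "y \<in> closed_segment A B" | "y \<in> closed_segment C A" | "y \<in> closed_segment B C"
      using y by (auto simp: T_eq)
    then show ?thesis
    proof cases
      case 1
      have "dist A y \<le> s" using dist_in_closed_segment[OF 1] sides by (simp add: dist_commute)
      moreover have "lipschitz_joined T (dist x A + dist A y) x y"
        using lipschitz_joined_trans[OF join[OF x_in _ sub(1), of A] join[OF _ 1 sub(1), of A]] by simp
      ultimately show ?thesis using xAd s by (intro exI[of _ "dist x A + dist A y"]) auto
    next
      case 2
      have "dist A y \<le> s" using dist_in_closed_segment[OF 2] sides by (simp add: dist_commute)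
      moreover have "lipschitz_joined T (dist x A + dist A y) x y"
        using lipschitz_joined_trans[OF join[OF x_in _ sub(1), of A] join[OF _ 2 sub(3), of A]] by simp
      ultimately show ?thesis using xAd s by (intro exI[of _ "dist x A + dist A y"]) auto
    next
      case 3
      then obtain t where t: "0 \<le> t" "t \<le> 1" "y = (1 - t) *\<^sub>R B + t *\<^sub>R C"
        by (auto simp: closed_segment_def)
      have yB: "y - B = t *\<^sub>R (C - B)" and yC: "C - y = (1 - t) *\<^sub>R (C - B)"
        unfolding t by (simp_all add: algebra_simps)
      have CB: "norm (C - B) = s" using sides by (simp add: dist_norm norm_minus_commute)
      have "dist B y = norm (y - B)" "dist C y = norm (C - y)"
        by (simp_all add: dist_norm norm_minus_commute)
      then have d: "dist B y = t * s" "dist C y = (1 - t) * s"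
        unfolding yB yC using t(1,2) CB by simp_all
      have viaB: "lipschitz_joined T (dist x B + dist B y) x y"
        using lipschitz_joined_trans[OF join[OF x_in _ sub(1), of B] join[OF _ 3 sub(2), of B]] by simp
      have viaAC: "lipschitz_joined T (dist x A + (dist A C + dist C y)) x y"
        using lipschitz_joined_trans[OF join[OF x_in _ sub(1), of A]
          lipschitz_joined_trans[OF join[of A C A C, OF _ _ sub(3)] join[OF _ 3 sub(2), of C]]] by simp
      have "t \<noteq> 3/4"
      proof
        assume t34: "t = 3/4"
        have "y - x = (3/4) *\<^sub>R (C - A)"
          unfolding t(3) t34 xA by (simp add: algebra_simps)
        then have "norm (y - x) = 3/4 * s" using sides by (simp add: dist_norm)
        moreover have "3/4 * s < height"
        proof -
          have "(3/4 * s)\<^sup>2 < height\<^sup>2"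
            using s by (simp add: power2_eq_square[of height] height_sq power_mult_distrib power_divide)
          then show ?thesis using height_pos power2_less_imp_less by fastforce
        qed
        ultimately show False using y(2) by (simp add: x_def)
      qed
      then consider "t < 3/4" | "t > 3/4" by linarith
      then show ?thesis
      proof cases
        case 1
        then have "t * s < 3/4 * s" using s by simp
        moreover have "0 \<le> t * s" using t s by simp
        ultimately have "0 \<le> dist x B + dist B y" "dist x B + dist B y < 3 / 2 * s"
          unfolding d xBd using s by linarith+
        then show ?thesis using viaB by blast
      next
        case 2
        then have "(1 - t) * s < 1/4 * s" using s by (intro mult_strict_right_mono) auto
        moreover have "dist A C = s" using sides by (simp add: dist_commute)
        moreover have "0 \<le> (1 - t) * s" using t s by simp
        ultimately have "0 \<le> dist x A + (dist A C + dist C y)" "dist x A + (dist A C + dist C y) < 3 / 2 * s"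
          unfolding d xAd using s by linarith+
        then show ?thesis using viaAC by blast
      qed
    qed
  qed
  then obtain L where "lipschitz_joined T L x y" "0 \<le> L" "L < 3 / 2 * s" by blast
  then have "intrinsic_dist T x y \<le> ennreal L" "ennreal L < ennreal (3 / 2 * s)"
    using intrinsic_dist_le by (auto simp: ennreal_less_iff)
  then show ?thesis by (simp add: x_def)
qed

end

section \<open>The volume bound\<close>

lemma shadow_dist_le: "a \<noteq> b \<Longrightarrow> dist (shadow a b x) (shadow a b y) \<le> dist x (y :: real^'d)"
proof -
  assume ab: "a \<noteq> b"
  have "(dist (shadow a b x) (shadow a b y))\<^sup>2 = (\<Sum>j\<in>{a,b}. (y $ j - x $ j)\<^sup>2)"
    using ab by (simp add: dist_real2)
  also have "\<dots> \<le> (\<Sum>j\<in>UNIV. (y $ j - x $ j)\<^sup>2)"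
    by (intro sum_mono2) auto
  also have "\<dots> = (dist x y)\<^sup>2"
    by (simp add: dist_vec_def L2_set_def sum_nonneg dist_real_def power2_commute)
  finally show ?thesis by (rule power2_le_imp_le) simp
qed

lemma shadow_isometry:
  assumes ab: "a \<noteq> b" and U: "UNIV = {a, b :: 'd}"
  shows "dist (shadow a b x) (shadow a b y) = dist x (y :: real^'d)"
proof -
  have "(dist (shadow a b x) (shadow a b y))\<^sup>2 = (dist x y)\<^sup>2"
    using ab by (simp add: dist_real2 dist_vec_def[of x] L2_set_def sum_nonneg dist_real_def power2_commute U)
  then show ?thesis by simp
qed

text \<open>
  Chords of the shadow are shadows of the chords that lie in the coordinate plane.
\<close>

lemma planar_shadow_pal:
  fixes K :: "(real^'d) set"
  assumes K: "compact K" "convex K" and w: "w > 0"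
    and diff: "chords_upto w K" and ab: "a \<noteq> b"
  shows "measure lebesgue (cylinder {a,b} K) > w\<^sup>2 / sqrt 3 \<or>
    measure lebesgue (cylinder {a,b} K) = w\<^sup>2 / sqrt 3 \<and>
    (\<exists>P Q R. shadow a b ` K = convex hull {P,Q,R} \<and>
      dist P Q = 2 * w / sqrt 3 \<and> dist Q R = 2 * w / sqrt 3 \<and> dist R P = 2 * w / sqrt 3)"
  unfolding measure_cylinder_pair[OF K(1) ab]
proof (rule pal)
  show "compact (shadow a b ` K)" by (intro compact_continuous_image continuous_on_shadow K)
  show "convex (shadow a b ` K)" by (intro convex_linear_image linear_shadow K)
  show "chords_upto w (shadow a b ` K)"
    unfolding chords_upto_def
  proof (intro allI impI)
    fix v :: "real^2" assume v: "norm v \<le> w"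
    define v' :: "real^'d" where "v' = (\<chi> j. if j = a then v $ 1 else if j = b then v $ 2 else 0)"
    have "(norm v')\<^sup>2 = (\<Sum>j\<in>UNIV. (v' $ j)\<^sup>2)"
      by (simp add: norm_vec_def L2_set_def sum_nonneg)
    also have "\<dots> = (\<Sum>j\<in>{a,b}. (v' $ j)\<^sup>2)"
      by (rule sum.mono_neutral_right) (auto simp: v'_def)
    also have "\<dots> = (norm v)\<^sup>2"
      using ab by (simp add: v'_def norm_vec_def L2_set_def sum_2)
    finally have "norm v' = norm v" by simp
    then obtain p q where pq: "p \<in> K" "q \<in> K" "q - p = v'" using chords_uptoD[OF diff, of v'] v by auto
    have "shadow a b q - shadow a b p = shadow a b (q - p)"
      by (simp add: linear_diff[OF linear_shadow])
    also have "\<dots> = v" unfolding pq(3) using ab by (simp add: vec_eq_iff forall_2 v'_def)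
    finally show "\<exists>p\<in>shadow a b ` K. \<exists>q\<in>shadow a b ` K. q - p = v" using pq by blast
  qed
qed (rule w)

lemma hausdorff_measure_gt_planar:
  fixes K :: "(real^'d) set"
  assumes d2: "CARD('d) = 2" and K: "compact K" "convex K" and w: "w > 0"
    and diff: "chords_upto w K"
  shows "ennreal (K_const 2 * w ^ 2) < hausdorff_measure 2 K \<or>
    ennreal (K_const 2 * w ^ 2) \<le> hausdorff_measure 2 K \<and>
    (\<exists>A B C. K = convex hull {A,B,C} \<and>
      dist A B = 2 * w / sqrt 3 \<and> dist B C = 2 * w / sqrt 3 \<and> dist C A = 2 * w / sqrt 3)"
proof -
  obtain a b :: 'd where U: "UNIV = {a,b}" and ab: "a \<noteq> b"
    using d2 card_2_iff[of "UNIV :: 'd set"] by blast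
  have "ennreal (measure lebesgue (cylinder {a,b} K)) = emeasure lborel K"
    using emeasure_cylinder[OF K(1), of "{a,b}"] by (simp flip: U)
  then have H: "ennreal (measure lebesgue (cylinder {a,b} K)) \<le> hausdorff_measure 2 K"
    using lborel_le_hausdorff_measure[of K] d2 by simp
  have k: "K_const 2 * w ^ 2 = w\<^sup>2 / sqrt 3" by (simp add: K_const_def)
  from planar_shadow_pal[OF K w diff ab] show ?thesis
  proof (elim disjE conjE exE)
    assume "measure lebesgue (cylinder {a,b} K) > w\<^sup>2 / sqrt 3"
    then have "ennreal (w\<^sup>2 / sqrt 3) < ennreal (measure lebesgue (cylinder {a,b} K))"
      by (simp add: ennreal_less_iff)
    then show ?thesis using H k by (metis less_le_trans)
  next
    fix P Q R assume m: "measure lebesgue (cylinder {a,b} K) = w\<^sup>2 / sqrt 3"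
      and hull: "shadow a b ` K = convex hull {P,Q,R}"
      and d: "dist P Q = 2 * w / sqrt 3" "dist Q R = 2 * w / sqrt 3" "dist R P = 2 * w / sqrt 3"
    define g :: "real^2 \<Rightarrow> real^'d" where "g = (\<lambda>y. \<chi> j. if j = a then y $ 1 else y $ 2)"
    have gs: "g (shadow a b x) = x" for x
    proof -
      have "j = a \<or> j = b" for j using U by blast
      then show ?thesis using ab by (auto simp: g_def vec_eq_iff)
    qed
    have sg: "shadow a b (g y) = y" for y
      using ab by (simp add: vec_eq_iff forall_2 g_def)
    have ling: "linear g" by (rule linearI) (simp_all add: vec_eq_iff g_def)
    have "K = g ` shadow a b ` K" by (simp add: image_image gs)
    also have "\<dots> = convex hull {g P, g Q, g R}"
      unfolding hull by (simp add: convex_hull_linear_image[OF ling])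
    finally have "K = convex hull {g P, g Q, g R}" .
    moreover have "dist (g x) (g y) = dist x y" for x y
      using shadow_isometry[OF ab U, of "g x" "g y"] by (simp add: sg)
    ultimately show ?thesis using H m d k by metis
  qed
qed

text \<open>
  The body is rotated so that a diameter \<open>D\<close> points along the axis \<open>c\<close>. The planar shadow on the axes \<open>a\<close> and
  \<open>b\<close> obeys the Pal inequality; the step that adds \<open>c\<close> uses the chord of length \<open>D\<close>, all others use chords of
  length \<open>w\<close>. If the Pal inequality is an equality, the shadow is a triangle of side
  \<open>2 * w / sqrt 3\<close>, and \<open>D\<close> is at least that long and exceeds \<open>w\<close>. So one of the two estimates is
  strict.
\<close>

lemma hausdorff_measure_gt_higher:
  fixes K :: "(real^'d) set"
  assumes d3: "CARD('d) \<ge> 3" and K: "compact K" "convex K" and w: "w > 0"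
    and diff: "chords_upto w K"
  shows "ennreal (K_const CARD('d) * w ^ CARD('d)) < hausdorff_measure CARD('d) K"
proof -
  let ?m = "CARD('d)"
  obtain S :: "'d set" where "card S = 3" using obtain_subset_with_card_n[OF d3] by blast
  then obtain a b c :: 'd where abc: "a \<noteq> b" "a \<noteq> c" "b \<noteq> c" by (auto simp: card_3_iff)
  define D where "D = diameter K"
  have Kne: "K \<noteq> {}" using chords_uptoD[OF diff, of 0] w by auto
  have bK: "bounded K" using K by (simp add: compact_imp_bounded)
  obtain p0 q0 where pq0: "p0 \<in> K" "q0 \<in> K" "dist p0 q0 = D"
    using diameter_compact_attained[OF K(1) Kne] by (auto simp: D_def)
  obtain f where f: "orthogonal_transformation f" "f (q0 - p0) = axis c D"
  proof (rule orthogonal_transformation_exists)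
    have "D \<ge> 0" using pq0(3) by auto
    moreover have "axis c D = D *\<^sub>R axis c (1::real)" by (simp add: vec_eq_iff axis_def)
    ultimately show "norm (q0 - p0) = norm (axis c D)"
      using pq0(3) by (simp add: dist_norm norm_minus_commute)
  qed
  have linf: "linear f" and isof: "dist (f x) (f y) = dist x y" for x y
    using f(1) by (auto simp: orthogonal_transformation_linear orthogonal_transformation_isometry)
  define K' where "K' = f ` K"
  have K': "compact K'" "convex K'"
    unfolding K'_def using K linf linear_continuous_on[of f K]
    by (auto intro: compact_continuous_image convex_linear_image simp: linear_conv_bounded_linear)
  have diff': "chords_upto w K'"
    unfolding chords_upto_def
  proof (intro allI impI)
    fix v :: "real^'d" assume "norm v \<le> w"
    obtain v0 where v0: "v = f v0" using orthogonal_transformation_surj[OF f(1)] by blast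
    then have "norm v0 \<le> w" using \<open>norm v \<le> w\<close> orthogonal_transformation_norm[OF f(1)] by metis
    then obtain p q where "p \<in> K" "q \<in> K" "q - p = v0" using chords_uptoD[OF diff] by blast
    then have "f q - f p = v" using linear_diff[OF linf, of q p] by (simp add: v0)
    then show "\<exists>p\<in>K'. \<exists>q\<in>K'. q - p = v" unfolding K'_def using \<open>p \<in> K\<close> \<open>q \<in> K\<close> by blast
  qed
  have diam: "dist x y \<le> D" if "x \<in> K'" "y \<in> K'" for x y
    using that diameter_bounded_bound[OF bK] isof by (auto simp: K'_def D_def)
  have nax: "norm (axis i t :: real^'d) = \<bar>t\<bar>" for i t
  proof -
    have "axis i t = t *\<^sub>R axis i (1::real)" by (simp add: vec_eq_iff axis_def)
    then show ?thesis by simp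
  qed
  have wD: "w \<le> D"
  proof -
    obtain p q where "p \<in> K'" "q \<in> K'" "q - p = axis c w" using chords_uptoD[OF diff', of "axis c w"] nax w by auto
    then show ?thesis using diam[of q p] nax[of c w] w by (simp add: dist_norm)
  qed
  define L where "L = (\<lambda>i. if i = c then D else w)"
  let ?J = "UNIV - {a,b}"
  define A where "A = measure lebesgue (cylinder {a,b} K')"
  have vol0: "measure lebesgue (cylinder ({a,b} \<union> ?J) K') \<ge>
    (\<Prod>i\<in>?J. L i) * fact (card {a,b}) / fact (card {a,b} + card ?J) * measure lebesgue (cylinder {a,b} K')"
  proof (rule measure_cylinder_iterate[OF K'])
    show "L i > 0" for i using w wD by (simp add: L_def)
    show "\<exists>p\<in>K'. \<exists>q\<in>K'. q - p = axis i (L i)" if "i \<in> ?J" for i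
    proof (cases "i = c")
      case True
      then show ?thesis using pq0 f(2) linear_diff[OF linf, of q0 p0] unfolding K'_def L_def by auto
    next
      case False
      then show ?thesis using chords_uptoD[OF diff', of "axis i w"] nax w by (simp add: L_def)
    qed
  qed auto
  have cJ: "card {a,b} + card ?J = ?m" "card {a,b} = 2"
    using abc d3 by (simp_all add: card_Diff_subset)
  have "{a,b} \<union> ?J = UNIV" by auto
  then have vol: "measure lebesgue K' \<ge> (\<Prod>i\<in>?J. L i) * 2 / fact ?m * A"
    using vol0 unfolding cJ(1) A_def by (simp add: cJ(2))
  have prodL: "(\<Prod>i\<in>?J. L i) = D * w ^ (?m - 3)"
  proof -
    have "(\<Prod>i\<in>?J. L i) = L c * (\<Prod>i\<in>?J - {c}. L i)"
      using abc by (intro prod.remove) auto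
    also have "(\<Prod>i\<in>?J - {c}. L i) = w ^ card (?J - {c})"
      by (simp add: L_def)
    also have "card (?J - {c}) = ?m - 3"
      using abc cJ by simp
    finally show ?thesis by (simp add: L_def)
  qed
  have planar: "A > w\<^sup>2 / sqrt 3 \<or> A = w\<^sup>2 / sqrt 3 \<and> D > w"
    using planar_shadow_pal[OF K' w diff' abc(1)]
  proof (elim disjE conjE exE)
    fix P Q R assume A: "measure lebesgue (cylinder {a,b} K') = w\<^sup>2 / sqrt 3"
      and hull: "shadow a b ` K' = convex hull {P,Q,R}" and PQ: "dist P Q = 2 * w / sqrt 3"
    have "P \<in> shadow a b ` K'" "Q \<in> shadow a b ` K'" unfolding hull by (auto intro: hull_inc)
    then obtain p q where "p \<in> K'" "q \<in> K'" "P = shadow a b p" "Q = shadow a b q" by auto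
    then have "2 * w / sqrt 3 \<le> D"
      using shadow_dist_le[OF abc(1), of p q] diam[of p q] PQ by simp
    moreover have "w < 2 * w / sqrt 3"
    proof -
      have "sqrt 3 < 2" by (rule real_less_lsqrt) auto
      then show ?thesis using w by (simp add: field_simps)
    qed
    ultimately show ?thesis using A by (simp add: A_def)
  qed (simp add: A_def)
  have "w * (w\<^sup>2 / sqrt 3) < D * A"
    using planar
  proof
    assume "A > w\<^sup>2 / sqrt 3"
    then have "w * (w\<^sup>2 / sqrt 3) < w * A" using w by (rule mult_strict_left_mono)
    also have "\<dots> \<le> D * A" using wD by (intro mult_right_mono) (simp_all add: A_def)
    finally show ?thesis .
  next
    assume "A = w\<^sup>2 / sqrt 3 \<and> D > w"
    moreover have "w\<^sup>2 / sqrt 3 > 0" using w by simp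
    ultimately show ?thesis using mult_strict_right_mono[of w D "w\<^sup>2 / sqrt 3"] by metis
  qed
  then have "w ^ (?m - 3) * 2 / fact ?m * (w * (w\<^sup>2 / sqrt 3)) < w ^ (?m - 3) * 2 / fact ?m * (D * A)"
    using w by (intro mult_strict_left_mono) auto
  moreover have "w ^ (?m - 3) * 2 / fact ?m * (w * (w\<^sup>2 / sqrt 3)) = K_const ?m * w ^ ?m"
  proof -
    have "w ^ ?m = w ^ (?m - 3) * w ^ 3" using d3 by (simp flip: power_add)
    then show ?thesis by (simp add: K_const_def power2_eq_square power3_eq_cube mult_ac)
  qed
  moreover have "w ^ (?m - 3) * 2 / fact ?m * (D * A) = (\<Prod>i\<in>?J. L i) * 2 / fact ?m * A"
    by (simp add: prodL mult_ac)
  ultimately have "K_const ?m * w ^ ?m < measure lebesgue K'"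
    using vol by linarith
  then have "ennreal (K_const ?m * w ^ ?m) < ennreal (measure lebesgue K')"
    using w by (simp add: ennreal_less_iff K_const_def)
  also have "\<dots> = emeasure lborel K'"
    using emeasure_cylinder[OF K'(1), of UNIV] by simp
  also have "\<dots> \<le> hausdorff_measure ?m K'" by (rule lborel_le_hausdorff_measure)
  also have "\<dots> \<le> hausdorff_measure ?m K"
    unfolding K'_def by (rule hausdorff_measure_nonexpansive_image) (simp add: isof)
  finally show ?thesis .
qed

text \<open>
  The point \<open>x\<close> is an end of an altitude that \<open>\<alpha>\<close> maps to the other end; the least displacement is compared
  with the displacement of the quarter point of a side.
\<close>

lemma equilateral_min_displacement_less:
  fixes A B C :: "'a::euclidean_space"
  assumes "equilateral_triangle A B C s"
    and \<Omega>: "\<Omega> = convex hull {A,B,C}"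
    and \<alpha>: "continuous_on (frontier \<Omega>) \<alpha>" "\<alpha> \<in> frontier \<Omega> \<rightarrow> frontier \<Omega>"
    and far: "\<And>x. x \<in> frontier \<Omega> \<Longrightarrow> sqrt 3 / 2 * s \<le> norm (\<alpha> x - x)"
  obtains x where "x \<in> frontier \<Omega>" "norm (\<alpha> x - x) = sqrt 3 / 2 * s"
    "min_displacement (frontier \<Omega>) \<alpha> < intrinsic_dist (frontier \<Omega>) x (\<alpha> x)"
proof -
  interpret equilateral_triangle A B C s by fact
  have T: "frontier \<Omega> = T" by (simp add: T_def \<Omega>)
  have \<Omega>': "compact \<Omega>" "convex \<Omega>" "\<Omega> \<noteq> {}"
    by (auto simp: \<Omega> finite_imp_compact_convex_hull)
  obtain x c where x: "x \<in> T" "\<alpha> x - x = c *\<^sub>R u"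
    using opposite_pair_along_direction[OF \<Omega>' \<alpha> norm_u] unfolding T by blast
  have c: "\<bar>c\<bar> \<ge> height" using far[of x] x norm_u by (simp add: T height_def)
  have vf: "x = A \<and> \<alpha> x = foot \<or> x = foot \<and> \<alpha> x = A"
    using vertical_chord[OF x(1) _ x(2) c] \<alpha>(2) x(1) unfolding T by auto
  then have "norm (\<alpha> x - x) = norm (A - foot)" by (auto simp: norm_minus_commute)
  then have 1: "norm (\<alpha> x - x) = sqrt 3 / 2 * s"
    using norm_u height_pos by (simp add: A_foot_u) (simp add: height_def)
  define y where "y = A + (1/4) *\<^sub>R (B - A)"
  have "y = (1 - 1/4) *\<^sub>R A + (1/4) *\<^sub>R B"
    by (simp add: y_def algebra_simps flip: scaleR_left_distrib)
  then have "y \<in> closed_segment A B"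
    unfolding closed_segment_def by (auto intro!: exI[of _ "1/4"])
  then have y: "y \<in> T" by (auto simp: T_eq)
  have "min_displacement T \<alpha> \<le> intrinsic_dist T y (\<alpha> y)"
    unfolding min_displacement_def by (rule INF_lower[OF y])
  also have "\<dots> < ennreal (3 / 2 * s)"
    unfolding y_def using far[of y] y \<alpha>(2)
    by (intro intrinsic_dist_quarter_point) (auto simp: T height_def y_def)
  also have "\<dots> \<le> intrinsic_dist T x (\<alpha> x)" by (rule intrinsic_dist_vertex_foot[OF vf])
  finally show thesis using that[of x] x(1) 1 by (simp add: T)
qed

lemma intrinsic_dist_le_distortion:
  assumes x: "x \<in> M" "\<alpha> x \<noteq> x"
  shows "intrinsic_dist M x (\<alpha> x) \<le> max_distortion M \<alpha> * ennreal (norm (\<alpha> x - x))"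
proof -
  let ?e = "ennreal (norm (\<alpha> x - x))"
  have "?e \<noteq> 0" using x(2) by simp
  then have "intrinsic_dist M x (\<alpha> x) = intrinsic_dist M x (\<alpha> x) / ?e * ?e"
    by (simp add: ennreal_divide_times ennreal_divide_self)
  also have "\<dots> \<le> max_distortion M \<alpha> * ?e"
    unfolding max_distortion_def by (intro mult_right_mono SUP_upper x) simp
  finally show ?thesis .
qed

theorem proposition3p1:
  fixes n :: nat
    and M \<Omega> :: "(real ^ 'd) set"
    and \<alpha> :: "real ^ 'd \<Rightarrow> real ^ 'd"
  assumes "n \<ge> 1"
    and "CARD('d) = n + 1"
    and "closed_convex_hypersurface_enclosing M \<Omega>"
    and "continuous_on M \<alpha>"
    and "\<alpha> \<in> M \<rightarrow> M"
    and "\<forall>x \<in> M. \<alpha> x \<noteq> x"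
  shows "hausdorff_measure (n + 1) \<Omega> >
           (ennreal (K_const (n + 1)) / max_distortion M \<alpha> ^ (n + 1)) * min_displacement M \<alpha> ^ (n + 1)"
proof -
  let ?m = "n + 1" and ?\<rho> = "max_distortion M \<alpha>" and ?\<mu> = "min_displacement M \<alpha>"
  let ?H = "hausdorff_measure ?m \<Omega>"
  have \<Omega>: "compact \<Omega>" "convex \<Omega>" "interior \<Omega> \<noteq> {}" and M: "M = frontier \<Omega>"
    using assms(3) by (auto simp: closed_convex_hypersurface_enclosing_def)
  have \<Omega>ne: "\<Omega> \<noteq> {}" using \<Omega>(3) by auto
  note \<alpha> = assms(4,5)[unfolded M]
  have cM: "compact M" unfolding M using \<Omega> by (simp add: compact_frontier)
  have "M \<noteq> {}"
  proof -
    have "\<Omega> \<noteq> UNIV" using \<Omega>(1) compact_imp_bounded not_bounded_UNIV by blast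
    then show ?thesis unfolding M using frontier_eq_empty[of \<Omega>] \<Omega>ne by simp
  qed
  moreover have "continuous_on M (\<lambda>x. norm (\<alpha> x - x))"
    using assms(4) by (intro continuous_intros)
  ultimately obtain x0 where x0: "x0 \<in> M" "\<And>x. x \<in> M \<Longrightarrow> norm (\<alpha> x0 - x0) \<le> norm (\<alpha> x - x)"
    using continuous_attains_inf[OF cM] by blast
  define \<delta> where "\<delta> = norm (\<alpha> x0 - x0)"
  have \<delta>: "\<delta> > 0" using assms(6) x0(1) by (simp add: \<delta>_def)
  have chords: "chords_upto \<delta> \<Omega>"
    using chords_upto_min_displacement[OF \<Omega>(1,2) \<Omega>ne \<alpha>] x0(2) unfolding M \<delta>_def by blast
  have K0: "K_const ?m > 0" by (simp add: K_const_def)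
  have \<mu>\<rho>: "?\<mu> \<le> ?\<rho> * ennreal (norm (\<alpha> x - x))" if "x \<in> M" for x
  proof -
    have "?\<mu> \<le> intrinsic_dist M x (\<alpha> x)"
      unfolding min_displacement_def by (rule INF_lower[OF that])
    also have "\<dots> \<le> ?\<rho> * ennreal (norm (\<alpha> x - x))"
      using intrinsic_dist_le_distortion[OF that] assms(6) that by blast
    finally show ?thesis .
  qed
  \<comment> \<open>In the extremal planar case the bound on the volume is not strict, but then \<open>?\<mu>\<close> is strictly smaller.\<close>
  have weak: "ennreal (K_const ?m * \<delta> ^ ?m) < ?H \<or>
    ennreal (K_const ?m * \<delta> ^ ?m) \<le> ?H \<and> ?\<mu> < ?\<rho> * ennreal \<delta>"
  proof (cases "n = 1")
    case False
    then have "CARD('d) \<ge> 3" using assms(1,2) by simp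
    then show ?thesis using hausdorff_measure_gt_higher[OF _ \<Omega>(1,2) \<delta> chords] assms(2) by simp
  next
    case True
    then have d2: "CARD('d) = 2" using assms(2) by simp
    from hausdorff_measure_gt_planar[OF d2 \<Omega>(1,2) \<delta> chords] show ?thesis
    proof (elim disjE conjE exE)
      fix A B C
      assume le: "ennreal (K_const 2 * \<delta>\<^sup>2) \<le> hausdorff_measure 2 \<Omega>"
        and hull: "\<Omega> = convex hull {A,B,C}"
        and sides: "dist A B = 2 * \<delta> / sqrt 3" "dist B C = 2 * \<delta> / sqrt 3" "dist C A = 2 * \<delta> / sqrt 3"
      have tri: "equilateral_triangle A B C (2 * \<delta> / sqrt 3)"
        using d2 \<delta> sides by unfold_locales auto
      have h: "sqrt 3 / 2 * (2 * \<delta> / sqrt 3) = \<delta>" by simp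
      obtain x where x: "x \<in> M" "norm (\<alpha> x - x) = \<delta>" "?\<mu> < intrinsic_dist M x (\<alpha> x)"
        using equilateral_min_displacement_less[OF tri hull \<alpha>, unfolded h, folded M]
          x0(2)[folded \<delta>_def] by blast
      have "intrinsic_dist M x (\<alpha> x) \<le> ?\<rho> * ennreal \<delta>"
        using intrinsic_dist_le_distortion[OF x(1)] assms(6) x(1,2) by metis
      then have "?\<mu> < ?\<rho> * ennreal \<delta>" using x(3) by (rule less_le_trans[rotated])
      then show ?thesis using le True by (simp add: numeral_2_eq_2)
    qed (simp add: True numeral_2_eq_2)
  qed
  then have Hpos: "?H > 0"
    using K0 \<delta> by (metis (no_types, lifting) ennreal_less_zero_iff less_le_trans mult_pos_pos not_less_zero
        zero_less_power zero_less_iff_neq_zero)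
  consider "?\<rho> = \<infinity>" | "?\<rho> = 0" | r where "?\<rho> = ennreal r" "r > 0"
    by (metis ennreal_cases infinity_ennreal_def ennreal_0 order_le_less)
  then show ?thesis
  proof cases
    case 1
    then show ?thesis using Hpos by (simp add: top_power_ennreal)
  next
    case 2
    then have "?\<mu> = 0" using \<mu>\<rho>[OF x0(1)] by simp
    then show ?thesis using Hpos by simp
  next
    case (3 r)
    have "?\<mu> \<le> ennreal (r * \<delta>)"
      using \<mu>\<rho>[OF x0(1)] 3 \<delta> by (simp add: \<delta>_def ennreal_mult')
    then obtain u where u: "?\<mu> = ennreal u" "u \<ge> 0"
      by (metis ennreal_cases ennreal_less_top infinity_ennreal_def leD top_neq_ennreal)
    have ule: "u \<le> r * \<delta>" using \<open>?\<mu> \<le> ennreal (r * \<delta>)\<close> 3(2) \<delta> by (simp add: u ennreal_le_iff)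
    have lhs: "(ennreal (K_const ?m) / ?\<rho> ^ ?m) * ?\<mu> ^ ?m = ennreal (K_const ?m * (u / r) ^ ?m)"
      using 3 u K0 by (simp add: ennreal_power divide_ennreal power_divide flip: ennreal_mult' del: power_Suc)
    have ur: "0 \<le> u / r" "u / r \<le> \<delta>" using 3(2) u ule by (simp_all add: field_simps)
    from weak show ?thesis
    proof
      assume "ennreal (K_const ?m * \<delta> ^ ?m) < ?H"
      moreover have "K_const ?m * (u / r) ^ ?m \<le> K_const ?m * \<delta> ^ ?m"
        using K0 ur by (intro mult_left_mono power_mono) auto
      ultimately show ?thesis unfolding lhs by (meson ennreal_leI le_less_trans)
    next
      assume w: "ennreal (K_const ?m * \<delta> ^ ?m) \<le> ?H \<and> ?\<mu> < ?\<rho> * ennreal \<delta>"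
      then have "ennreal u < ennreal (r * \<delta>)" using 3 u \<delta> by (simp add: ennreal_mult')
      then have "u / r < \<delta>" using 3(2) u by (simp add: ennreal_less_iff field_simps)
      then have "K_const ?m * (u / r) ^ ?m < K_const ?m * \<delta> ^ ?m"
        using K0 ur by (intro mult_strict_left_mono power_strict_mono) auto
      then have "ennreal (K_const ?m * (u / r) ^ ?m) < ennreal (K_const ?m * \<delta> ^ ?m)"
        using K0 \<delta> by (intro ennreal_lessI) auto
      then show ?thesis unfolding lhs using w by (blast intro: less_le_trans)
    qed
  qed
qed

end
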